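(* Let $\kappa$ be an uncountable ordinal number such that each set of reals of cardinality less than $\kappa$ is productively $\mathsf S_1(\Gamma,\Gamma)$. Let $m$ be a natural number, let $X_1,\dots,X_m\subseteq[\mathbb N]^\infty$ be $\kappa$-generalized towers, and let $Y$ be a set of reals satisfying $\binom{\Omega}{\Gamma}$. Then the product space $(X_1\cup\mathrm{Fin})\times\dots\times(X_m\cup\mathrm{Fin})\times Y$ satisfies $\mathsf S_1(\Gamma,\Gamma)$.
   Context: $\mathbb N=\{1,2,\dots\}$; $[\mathbb N]^\infty$ is the set of infinite subsets of $\mathbb N$ and $\mathrm{Fin}$ the set of finite subsets of $\mathbb N$. Both are viewed as subspaces of $P(\mathbb N)$, which is identified with the Cantor space $\{0,1\}^{\mathbb N}$ via characteristic functions. Each $a\in[\mathbb N]^\infty$ is identified with its increasing enumeration $a(1)<a(2)<\cdots$. For $n<m$, $[n,m)=\{i\in\mathbb N: n\le i<m\}$. A set of reals is a space homeomorphic to a subset of the real line. For an uncountable ordinal $\kappa$, a set $X\subseteq[\mathbb N]^\infty$ with $|X|\ge\kappa$ is a $\kappa$-generalized tower if for each $a\in[\mathbb N]^\infty$ there are $b\in[\mathbb N]^\infty$ and $S\subseteq X$ with $|S|<\kappa$ such that $x\cap\bigcup_{n\in b}[a(n),a(n+1))$ is finite for all $x\in X\setminus S$. A cover of a space is a family of proper subsets whose union is the whole space. An $\omega$-cover is an open cover such that each finite subset of the space is contained in a member of the cover. A $\gamma$-cover is an infinite cover such that each point belongs to all but finitely many members; $\Gamma(X)$ is the family of all open $\gamma$-covers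 of $X$. A space satisfies $\binom{\Omega}{\Gamma}$ if every $\omega$-cover of it contains a $\gamma$-cover of it. $X$ satisfies $\mathsf S_1(\Gamma,\Gamma)$ if for each sequence $\mathcal U_1,\mathcal U_2,\dots\in\Gamma(X)$ there are $U_1\in\mathcal U_1,U_2\in\mathcal U_2,\dots$ with $\{U_n:n\in\mathbb N\}\in\Gamma(X)$. A set of reals is productively $\mathsf S_1(\Gamma,\Gamma)$ if its product with every set of reals satisfying $\mathsf S_1(\Gamma,\Gamma)$ satisfies $\mathsf S_1(\Gamma,\Gamma)$. *)

theory Defs
  imports "HOL-Analysis.Analysis"
begin

unbundle cardinal_syntax

text \<open>Throughout, the natural numbers start at 1: subsets of \<open>\<nat>\<close> are sets contained in \<open>{1..}\<close>.\<close>

definition inf_subsets :: "nat set set" where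
  "inf_subsets = {a. a \<subseteq> {1..} \<and> infinite a}"

definition fin_subsets :: "nat set set" where
  "fin_subsets = {a. a \<subseteq> {1..} \<and> finite a}"

text \<open>The power set of \<open>\<nat>\<close> with the topology that makes the characteristic function map
  a homeomorphism onto the Cantor space.\<close>

definition cantor_pow :: "nat set topology" where
  "cantor_pow = pullback_topology (Pow {1..}) (\<lambda>a. \<lambda>n\<in>{1..}. n \<in> a)
     (product_topology (\<lambda>_. discrete_topology (UNIV :: bool set)) {1..})"

text \<open>Increasing enumeration \<open>a(1) < a(2) < \<dots>\<close>; the library's \<open>enumerate\<close> counts from 0.\<close>

definition enum1 :: "nat set \<Rightarrow> nat \<Rightarrow> nat" where
  "enum1 a n = enumerate a (n - 1)"

text \<open>An ordinal is represented by a well-order \<open>\<kappa>\<close> on an arbitrary type; \<open>|X|\<close> is the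
  initial ordinal of the cardinality of \<open>X\<close>.\<close>

definition generalized_tower :: "'k rel \<Rightarrow> nat set set \<Rightarrow> bool" where
  "generalized_tower \<kappa> X \<longleftrightarrow>
     X \<subseteq> inf_subsets \<and> \<kappa> \<le>o |X| \<and>
     (\<forall>a\<in>inf_subsets. \<exists>b\<in>inf_subsets. \<exists>S\<subseteq>X. |S| <o \<kappa> \<and>
        (\<forall>x\<in>X - S. finite (x \<inter> (\<Union>n\<in>b. {enum1 a n..<enum1 a (n + 1)}))))"

definition set_of_reals :: "'a topology \<Rightarrow> bool" where
  "set_of_reals T \<longleftrightarrow> (\<exists>A :: real set. T homeomorphic_space top_of_set A)"

definition cover_of :: "'a topology \<Rightarrow> 'a set set \<Rightarrow> bool" where
  "cover_of T \<U> \<longleftrightarrow> (\<forall>u\<in>\<U>. u \<subset> topspace T) \<and> \<Union>\<U> = topspace T"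

definition open_cover_of :: "'a topology \<Rightarrow> 'a set set \<Rightarrow> bool" where
  "open_cover_of T \<U> \<longleftrightarrow> cover_of T \<U> \<and> (\<forall>u\<in>\<U>. openin T u)"

definition omega_cover :: "'a topology \<Rightarrow> 'a set set \<Rightarrow> bool" where
  "omega_cover T \<U> \<longleftrightarrow>
     open_cover_of T \<U> \<and> (\<forall>F. finite F \<and> F \<subseteq> topspace T \<longrightarrow> (\<exists>u\<in>\<U>. F \<subseteq> u))"

definition gamma_cover :: "'a topology \<Rightarrow> 'a set set \<Rightarrow> bool" where
  "gamma_cover T \<U> \<longleftrightarrow>
     cover_of T \<U> \<and> infinite \<U> \<and> (\<forall>x\<in>topspace T. finite {u\<in>\<U>. x \<notin> u})"

definition open_gamma_covers :: "'a topology \<Rightarrow> 'a set set set" where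
  "open_gamma_covers T = {\<U>. gamma_cover T \<U> \<and> (\<forall>u\<in>\<U>. openin T u)}"

definition omega_gamma :: "'a topology \<Rightarrow> bool" where
  "omega_gamma T \<longleftrightarrow> (\<forall>\<U>. omega_cover T \<U> \<longrightarrow> (\<exists>\<V>\<subseteq>\<U>. gamma_cover T \<V>))"

definition S1_gamma_gamma :: "'a topology \<Rightarrow> bool" where
  "S1_gamma_gamma T \<longleftrightarrow>
     (\<forall>\<U> :: nat \<Rightarrow> 'a set set. (\<forall>n. \<U> n \<in> open_gamma_covers T) \<longrightarrow>
        (\<exists>U. (\<forall>n. U n \<in> \<U> n) \<and> range U \<in> open_gamma_covers T))"

text \<open>Every set of reals is homeomorphic to a topology whose points are real numbers, so
  quantifying over such topologies covers all sets of reals up to homeomorphism.\<close>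

definition productively_S1_gamma_gamma :: "'a topology \<Rightarrow> bool" where
  "productively_S1_gamma_gamma T \<longleftrightarrow>
     (\<forall>Z :: real topology. set_of_reals Z \<and> S1_gamma_gamma Z \<longrightarrow>
        S1_gamma_gamma (prod_topology T Z))"

end

theory Submission
  imports Defs
begin

text \<open>Call \<open>j\<close> diagonal on \<open>P\<close> for an array \<open>U k j\<close> of open sets whose rows converge to the whole
  space if every point of \<open>P\<close> lies, for almost all \<open>n\<close>, in all \<open>U k (j n)\<close> with \<open>k \<le> n\<close>. Since
  subsequences of diagonal sequences are diagonal, finitely many pieces of the space can be
  treated one after another. On the product of the spaces \<open>X i \<union> Fin\<close> with \<open>Y\<close>, the property of
  \<open>Y\<close> gives \<open>a\<close> and \<open>j\<close> such that points whose first coordinates miss \<open>[a n, a (n + 1))\<close> are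
  handled at stage \<open>n\<close>. By the tower property there is an infinite set of such \<open>n\<close> which, for each
  \<open>i\<close>, works for all points of \<open>X i\<close> outside a small set \<open>S i\<close>. What remains are the slices where
  the \<open>l\<close>-th coordinate is in \<open>S l\<close>; they are handled by productivity and induction on the number
  of towers. For productivity to apply, the smaller product must be a set of reals: \<open>Y\<close> contains no
  interval, so all factors are zero-dimensional and embed into the Cantor set.\<close>

section \<open>Diagonal sequences\<close>

text \<open>An indexed substitute for a sequence of \<gamma>-covers. Members may repeat or equal the
  whole space, so the notion survives preimages and the restriction to a sequence of columns, which
  families of proper subsets need not do.\<close>

definition gamma_array :: "'a topology \<Rightarrow> (nat \<Rightarrow> nat \<Rightarrow> 'a set) \<Rightarrow> bool" where
  "gamma_array T U \<longleftrightarrow> (\<forall>k j. openin T (U k j)) \<and>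
     (\<forall>x\<in>topspace T. \<forall>k. \<forall>\<^sub>F j in sequentially. x \<in> U k j)"

text \<open>Asking for all rows \<open>k \<le> n\<close>, not just row \<open>n\<close>, keeps the
  property under subsequences; \<open>n \<le> j n\<close> makes the chosen columns tend to
  infinity.\<close>

definition diagonal :: "(nat \<Rightarrow> nat \<Rightarrow> 'a set) \<Rightarrow> (nat \<Rightarrow> nat) \<Rightarrow> 'a set \<Rightarrow> bool" where
  "diagonal U j P \<longleftrightarrow> (\<forall>n. n \<le> j n) \<and> (\<forall>x\<in>P. \<forall>\<^sub>F n in sequentially. \<forall>k\<le>n. x \<in> U k (j n))"

text \<open>The array converges on all of \<open>T\<close>, the diagonal is only asked for on
  \<open>P\<close>. Pieces of a space are thus treated without passing to subspaces.\<close>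

definition gamma_selective :: "'a topology \<Rightarrow> 'a set \<Rightarrow> bool" where
  "gamma_selective T P \<longleftrightarrow> (\<forall>U. gamma_array T U \<longrightarrow> (\<exists>j. diagonal U j P))"

section \<open>Translation between covers and arrays\<close>

lemma filterlim_ge_sequentially:
  fixes f :: "nat \<Rightarrow> nat"
  assumes "\<And>n. n \<le> f n"
  shows "filterlim f sequentially sequentially"
  using filterlim_at_top_mono[OF filterlim_ident, of f] assms by simp

text \<open>Properness makes the range infinite: a set occurring infinitely often would miss some
  point infinitely often.\<close>

lemma range_in_open_gamma_covers:
  assumes op: "\<And>n. openin T (F n)" and pr: "\<And>n::nat. F n \<subset> topspace T"
    and ev: "\<And>x. x \<in> topspace T \<Longrightarrow> \<forall>\<^sub>F n in sequentially. x \<in> F n"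
  shows "range F \<in> open_gamma_covers T"
proof -
  have fin: "finite {n. x \<notin> F n}" if "x \<in> topspace T" for x
    using ev[OF that] by (simp flip: cofinite_eq_sequentially add: eventually_cofinite)
  have "infinite (range F)"
  proof
    assume "finite (range F)"
    then obtain n where "infinite {m. F m = F n}"
      using pigeonhole_infinite[of UNIV F] by auto
    moreover obtain x where "x \<in> topspace T" "x \<notin> F n" using pr[of n] by blast
    moreover from this have "{m. F m = F n} \<subseteq> {m. x \<notin> F m}" by auto
    ultimately show False using fin finite_subset by blast
  qed
  moreover have "topspace T \<subseteq> \<Union>(range F)"
  proof
    fix x assume "x \<in> topspace T"
    from ev[OF this] show "x \<in> \<Union>(range F)"
      using eventually_happens' sequentially_bot by blast
  qed
  moreover have "finite {u \<in> range F. x \<notin> u}" if "x \<in> topspace T" for x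
    by (rule finite_subset[OF _ finite_imageI[OF fin[OF that], of F]]) auto
  ultimately show ?thesis
    unfolding open_gamma_covers_def gamma_cover_def cover_of_def using op pr by blast
qed

text \<open>Each cover is infinite and so contains an injective sequence. Injectivity turns "all but
  finitely many members" into "almost all indices".\<close>

lemma gamma_selective_imp_S1_gamma_gamma:
  assumes "gamma_selective T (topspace T)"
  shows "S1_gamma_gamma T"
  unfolding S1_gamma_gamma_def
proof (intro allI impI)
  fix \<U> :: "nat \<Rightarrow> 'a set set"
  assume \<U>: "\<forall>n. \<U> n \<in> open_gamma_covers T"
  have "\<exists>f :: nat \<Rightarrow> 'a set. inj f \<and> range f \<subseteq> \<U> n" for n
    using \<U> infinite_countable_subset unfolding open_gamma_covers_def gamma_cover_def by blast
  then obtain U :: "nat \<Rightarrow> nat \<Rightarrow> 'a set"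
    where inj: "\<And>n. inj (U n)" and sub: "\<And>n. range (U n) \<subseteq> \<U> n" by metis
  have mem: "U n j \<in> \<U> n" for n j using sub by blast
  have op: "openin T (U n j)" and pr: "U n j \<subset> topspace T" for n j
    using mem[of n j] \<U> unfolding open_gamma_covers_def gamma_cover_def cover_of_def by blast+
  have "gamma_array T U"
    unfolding gamma_array_def
  proof (intro conjI allI ballI op)
    fix x k assume "x \<in> topspace T"
    then have "finite {u \<in> \<U> k. x \<notin> u}"
      using \<U> unfolding open_gamma_covers_def gamma_cover_def by blast
    then have "finite (U k -` {u \<in> \<U> k. x \<notin> u})" by (rule finite_vimageI[OF _ inj])
    moreover have "U k -` {u \<in> \<U> k. x \<notin> u} = {j. x \<notin> U k j}" using mem by auto
    ultimately show "\<forall>\<^sub>F j in sequentially. x \<in> U k j"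
      by (simp flip: cofinite_eq_sequentially add: eventually_cofinite)
  qed
  then obtain j where "diagonal U j (topspace T)"
    using assms unfolding gamma_selective_def by blast
  then have "\<forall>\<^sub>F n in sequentially. x \<in> U n (j n)" if "x \<in> topspace T" for x
    using that unfolding diagonal_def by (blast intro: eventually_mono)
  then have "range (\<lambda>n. U n (j n)) \<in> open_gamma_covers T"
    by (intro range_in_open_gamma_covers op pr)
  then show "\<exists>U. (\<forall>n. U n \<in> \<U> n) \<and> range U \<in> open_gamma_covers T"
    using mem by (intro exI[of _ "\<lambda>n. U n (j n)"]) auto
qed

text \<open>Apply \<open>S1_gamma_gamma\<close> to the covers formed by the sets \<open>\<Inter>k\<le>n. U k j\<close>. The same set may be selected
  infinitely often, so pass to a subsequence of pairwise different sets; a set selected at stage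
  \<open>n\<close> also serves all rows \<open>k \<le> n\<close>, which fills the gaps.\<close>

lemma S1_gamma_gamma_imp_gamma_selective:
  assumes S1: "S1_gamma_gamma T"
  shows "gamma_selective T (topspace T)"
  unfolding gamma_selective_def
proof (intro allI impI)
  fix U assume U: "gamma_array T U"
  have op: "openin T (U k j)" for k j using U unfolding gamma_array_def by blast
  show "\<exists>j. diagonal U j (topspace T)"
  proof (cases "\<forall>n. \<exists>j\<ge>n. \<forall>k\<le>n. U k j = topspace T")
    \<comment> \<open>Members of an array may be the whole space, members of a cover may not. If
      full columns occur arbitrarily late they form a diagonal at once; otherwise from some
      \<open>n0\<close> on every column has a proper member among its rows up to
      \<open>n0\<close>.\<close>
    case True
    then obtain j where "\<And>n. n \<le> j n" "\<And>n k. k \<le> n \<Longrightarrow> U k (j n) = topspace T" by metis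
    then have "diagonal U j (topspace T)" unfolding diagonal_def by auto
    then show ?thesis by blast
  next
    case False
    then obtain n0 where n0: "\<And>j. j \<ge> n0 \<Longrightarrow> \<exists>k\<le>n0. U k j \<noteq> topspace T" by blast
    \<comment> \<open>Starting at row and column \<open>n0\<close> makes every \<open>D n i\<close>
      a proper subset; the offset \<open>n\<close> in the column number later yields
      \<open>n \<le> j n\<close>.\<close>
    define D where "D n i = (\<Inter>k\<in>{..n0 + n}. U k (n0 + n + i))" for n i
    have D: "range (D n) \<in> open_gamma_covers T" for n
    proof (rule range_in_open_gamma_covers)
      show "openin T (D n i)" for i
        unfolding D_def by (intro openin_INT2 op) auto
      show "D n i \<subset> topspace T" for i
      proof -
        obtain k where k: "k \<le> n0" "U k (n0 + n + i) \<noteq> topspace T"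
          using n0[of "n0 + n + i"] by auto
        then have "D n i \<subseteq> U k (n0 + n + i)" unfolding D_def by (intro INF_lower) auto
        then show ?thesis using k(2) openin_subset[OF op[of k "n0 + n + i"]] by blast
      qed
      fix x assume "x \<in> topspace T"
      then have "\<forall>\<^sub>F j in sequentially. \<forall>k\<in>{..n0 + n}. x \<in> U k j"
        using U unfolding gamma_array_def by (intro eventually_ball_finite) auto
      then have "\<forall>\<^sub>F i in sequentially. \<forall>k\<in>{..n0 + n}. x \<in> U k (n0 + n + i)"
        by (rule eventually_compose_filterlim[OF _ filterlim_ge_sequentially]) simp
      then show "\<forall>\<^sub>F i in sequentially. x \<in> D n i" by (simp add: D_def)
    qed
    then obtain W where W: "\<And>n. W n \<in> range (D n)" "range W \<in> open_gamma_covers T"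
      using S1[unfolded S1_gamma_gamma_def, rule_format, of "\<lambda>n. range (D n)"] by blast
    have "\<forall>n. \<exists>i. W n = D n i"
    proof
      show "\<exists>i. W n = D n i" for n using W(1)[of n] by (auto simp only: image_iff)
    qed
    then obtain h where h: "\<And>n. W n = D n (h n)" using choice[of "\<lambda>n i. W n = D n i"] by auto
    obtain K where K: "inj_on W K" "W ` K = range W"
      using subset_image_inj[of "range W" W UNIV] by auto
    have "infinite K"
      using W(2) K(2) finite_imageI[of K W] unfolding open_gamma_covers_def gamma_cover_def by auto
    then have ge: "n \<le> enumerate K n" and inK: "enumerate K n \<in> K" for n
      by (auto simp: le_enumerate enumerate_in_set)
    define j where "j n = n0 + enumerate K n + h (enumerate K n)" for n
    have "\<forall>\<^sub>F n in sequentially. \<forall>k\<le>n. x \<in> U k (j n)" if "x \<in> topspace T" for x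
    proof -
      have "finite {u \<in> range W. x \<notin> u}"
        using W(2) that unfolding open_gamma_covers_def gamma_cover_def by blast
      then have "finite (W -` {u \<in> range W. x \<notin> u} \<inter> K)"
        using K(1) by (rule finite_vimage_IntI)
      then have "finite {n \<in> K. x \<notin> W n}" by (rule rev_finite_subset) auto
      then have "\<forall>\<^sub>F n in sequentially. n \<notin> {n \<in> K. x \<notin> W n}"
        by (simp flip: cofinite_eq_sequentially add: eventually_cofinite)
      then have "\<forall>\<^sub>F n in sequentially. enumerate K n \<notin> {n \<in> K. x \<notin> W n}"
        by (rule eventually_compose_filterlim[OF _ filterlim_ge_sequentially[OF ge]])
      then show ?thesis
      proof (rule eventually_mono, intro allI impI)
        fix n k assume "enumerate K n \<notin> {n \<in> K. x \<notin> W n}" "k \<le> n"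
        then have "x \<in> D (enumerate K n) (h (enumerate K n))" "k \<le> n0 + enumerate K n"
          using inK h ge[of n] by auto
        then show "x \<in> U k (j n)" unfolding D_def j_def by auto
      qed
    qed
    moreover have "n \<le> j n" for n unfolding j_def using ge[of n] by linarith
    ultimately have "diagonal U j (topspace T)" unfolding diagonal_def by blast
    then show ?thesis by blast
  qed
qed

section \<open>Images and finite unions of selective sets\<close>

text \<open>Preimages of an array under \<open>q\<close> form an array on \<open>T\<close>, and a
  diagonal for them serves the image points. This transfers selectivity along homeomorphisms and
  onto slices of a larger product.\<close>

lemma gamma_selective_image:
  assumes "gamma_selective T (topspace T)" and q: "continuous_map T Z q"
  shows "gamma_selective Z (q ` topspace T)"
  unfolding gamma_selective_def
proof (intro allI impI)
  fix U assume U: "gamma_array Z U"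
  define V where "V k j = {x \<in> topspace T. q x \<in> U k j}" for k j
  have "gamma_array T V"
    unfolding gamma_array_def
  proof (intro conjI allI ballI)
    show "openin T (V k j)" for k j
      using U q openin_continuous_map_preimage unfolding gamma_array_def V_def by blast
    fix x k assume x: "x \<in> topspace T"
    then have "q x \<in> topspace Z" using q continuous_map_image_subset_topspace by blast
    then show "\<forall>\<^sub>F j in sequentially. x \<in> V k j"
      using U x unfolding gamma_array_def V_def by simp
  qed
  then obtain j where "diagonal V j (topspace T)"
    using assms(1) unfolding gamma_selective_def by blast
  then have "diagonal U j (q ` topspace T)"
    unfolding diagonal_def V_def by simp
  then show "\<exists>j. diagonal U j (q ` topspace T)" by blast
qed

text \<open>The columns \<open>j n\<close> alone still form an array, to which the selectivity of
  \<open>Q\<close> applies. The resulting sequence is a subsequence of \<open>j\<close>, so the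
  points of \<open>P\<close> stay covered.\<close>

lemma diagonal_extend:
  assumes U: "gamma_array T U" and j: "diagonal U j P" and Q: "gamma_selective T Q"
  shows "\<exists>j'. diagonal U j' (P \<union> Q)"
proof -
  have ge: "n \<le> j n" for n using j unfolding diagonal_def by blast
  have "gamma_array T (\<lambda>k n. U k (j n))"
    unfolding gamma_array_def
  proof (intro conjI allI ballI)
    show "openin T (U k (j n))" for k n using U unfolding gamma_array_def by blast
    fix x k assume "x \<in> topspace T"
    then have "\<forall>\<^sub>F n in sequentially. x \<in> U k n" using U unfolding gamma_array_def by blast
    then show "\<forall>\<^sub>F n in sequentially. x \<in> U k (j n)"
      by (rule eventually_compose_filterlim[OF _ filterlim_ge_sequentially[OF ge]])
  qed
  then obtain i where i: "diagonal (\<lambda>k n. U k (j n)) i Q"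
    using Q unfolding gamma_selective_def by blast
  have gei: "n \<le> i n" for n using i unfolding diagonal_def by blast
  have "\<forall>\<^sub>F n in sequentially. \<forall>k\<le>n. x \<in> U k (j (i n))" if "x \<in> P" for x
  proof -
    have "\<forall>\<^sub>F n in sequentially. \<forall>k\<le>n. x \<in> U k (j n)" using j that unfolding diagonal_def by blast
    then have "\<forall>\<^sub>F n in sequentially. \<forall>k\<le>i n. x \<in> U k (j (i n))"
      by (rule eventually_compose_filterlim[OF _ filterlim_ge_sequentially[OF gei]])
    then show ?thesis by (rule eventually_mono) (use gei order_trans in blast)
  qed
  moreover have "n \<le> j (i n)" for n using ge gei order_trans by blast
  ultimately have "diagonal U (\<lambda>n. j (i n)) (P \<union> Q)"
    using i unfolding diagonal_def by blast
  then show ?thesis by blast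
qed

lemma diagonal_extend_finite:
  assumes U: "gamma_array T U" and "diagonal U j P"
    and "finite I" and "\<And>l. l \<in> I \<Longrightarrow> gamma_selective T (Q l)"
  shows "\<exists>j'. diagonal U j' (P \<union> (\<Union>l\<in>I. Q l))"
  using assms(3,4)
proof (induction I)
  case empty
  then show ?case using assms(2) by auto
next
  case (insert l I)
  then obtain j' where "diagonal U j' (P \<union> (\<Union>l\<in>I. Q l))" by blast
  from diagonal_extend[OF U this, of "Q l"] insert.prems show ?case
    by (simp add: Un_ac)
qed

section \<open>Selection from families that capture finite sets\<close>

text \<open>Gerlits--Nagy trick: removing a point \<open>p i\<close> from the members of \<open>\<V> i\<close>, with \<open>p\<close> injective,
  forces a \<open>\<gamma>\<close>-subcover of the union to use infinitely many indices \<open>i\<close>.\<close>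

lemma omega_gamma_select:
  fixes Y :: "'a topology"
  assumes Y: "omega_gamma Y" "t1_space Y"
    and fin: "\<And>i F. \<lbrakk>finite F; F \<subseteq> topspace Y\<rbrakk> \<Longrightarrow> \<exists>V\<in>\<V> i. F \<subseteq> V"
    and op: "\<And>i V. V \<in> \<V> i \<Longrightarrow> openin Y V"
  shows "\<exists>(r :: nat \<Rightarrow> nat) V. strict_mono r \<and> (\<forall>n. V n \<in> \<V> (r n)) \<and>
    (\<forall>y\<in>topspace Y. \<forall>\<^sub>F n in sequentially. y \<in> V n)"
proof (cases "finite (topspace Y)")
  case True
  \<comment> \<open>A finite space has no injective sequence of points, but here a single member of
    each family contains every point.\<close>
  then have "\<forall>n. \<exists>V\<in>\<V> n. topspace Y \<subseteq> V" using fin by blast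
  then obtain V where V: "\<And>n. V n \<in> \<V> n" "\<And>n. topspace Y \<subseteq> V n" by metis
  have "\<forall>y\<in>topspace Y. \<forall>\<^sub>F n in sequentially. y \<in> V n"
    using V(2) by (intro ballI always_eventually) blast
  with V(1) show ?thesis
    by (intro exI[of _ id] exI[of _ V]) (simp add: strict_mono_def)
next
  case False
  then obtain p :: "nat \<Rightarrow> 'a" where p: "inj p" "range p \<subseteq> topspace Y"
    using infinite_countable_subset by blast
  define \<W> where "\<W> = {V - {p i} | V i. V \<in> \<V> i}"
  have ex: "\<exists>u\<in>\<W>. F \<subseteq> u" if F: "finite F" "F \<subseteq> topspace Y" for F
  proof -
    \<comment> \<open>Injectivity of \<open>p\<close> leaves an index whose point is outside
      \<open>F\<close>, so removing that point does no harm to \<open>F\<close>.\<close>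
    have "finite (p -` F)" using F p by (simp add: finite_vimageI)
    then obtain i where "p i \<notin> F" using ex_new_if_finite[of "p -` F"] by auto
    moreover obtain V where "V \<in> \<V> i" "F \<subseteq> V" using fin F by blast
    ultimately have "V - {p i} \<in> \<W>" "F \<subseteq> V - {p i}" unfolding \<W>_def by auto
    then show ?thesis by (rule bexI[rotated])
  qed
  have opW: "openin Y u \<and> u \<subset> topspace Y" if u: "u \<in> \<W>" for u
  proof -
    obtain V i where Vi: "u = V - {p i}" "V \<in> \<V> i" using u unfolding \<W>_def by auto
    have "openin Y V" using op Vi by blast
    moreover have "closedin Y {p i}" using Y(2) p(2) by (simp add: t1_space_closedin_singleton range_subsetD)
    ultimately have "openin Y u" unfolding Vi by (rule openin_diff)
    moreover have "p i \<in> topspace Y" "p i \<notin> u" using p(2) Vi(1) by auto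
    ultimately show ?thesis using openin_subset[of Y u] by auto
  qed
  have "omega_cover Y \<W>"
    unfolding omega_cover_def open_cover_of_def cover_of_def
  proof (intro conjI ballI allI impI)
    show "\<Union>\<W> = topspace Y"
    proof
      show "topspace Y \<subseteq> \<Union>\<W>"
      proof
        fix y assume "y \<in> topspace Y"
        then show "y \<in> \<Union>\<W>" using ex[of "{y}"] by auto
      qed
      show "\<Union>\<W> \<subseteq> topspace Y" using opW by auto
    qed
  qed (simp_all add: opW ex)
  then obtain \<G> where \<G>: "\<G> \<subseteq> \<W>" "gamma_cover Y \<G>"
    using Y(1) unfolding omega_gamma_def by blast
  obtain \<iota> \<nu> where \<iota>: "\<And>u. u \<in> \<G> \<Longrightarrow> u = \<nu> u - {p (\<iota> u)} \<and> \<nu> u \<in> \<V> (\<iota> u)"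
  proof -
    have "\<exists>i V. u = V - {p i} \<and> V \<in> \<V> i" if "u \<in> \<G>" for u
      using subsetD[OF \<G>(1) that] unfolding \<W>_def by auto
    then show thesis using that by metis
  qed
  \<comment> \<open>Members with index \<open>i\<close> all miss the point \<open>p i\<close>, and a
    \<gamma>-cover has only finitely many such members.\<close>
  have fib: "finite {u \<in> \<G>. \<iota> u = i}" for i
  proof -
    have "finite {u \<in> \<G>. p i \<notin> u}" using \<G>(2) p(2) unfolding gamma_cover_def by blast
    then show ?thesis
    proof (rule rev_finite_subset)
      show "{u \<in> \<G>. \<iota> u = i} \<subseteq> {u \<in> \<G>. p i \<notin> u}" using \<iota> by fastforce
    qed
  qed
  have infG: "infinite \<G>" using \<G>(2) unfolding gamma_cover_def by blast
  have "infinite (\<iota> ` \<G>)"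
  proof
    assume "finite (\<iota> ` \<G>)"
    then have "finite (\<Union>i\<in>\<iota> ` \<G>. {u \<in> \<G>. \<iota> u = i})" using fib by blast
    moreover have "\<G> \<subseteq> (\<Union>i\<in>\<iota> ` \<G>. {u \<in> \<G>. \<iota> u = i})" by blast
    ultimately show False using infG finite_subset by blast
  qed
  define r where "r = enumerate (\<iota> ` \<G>)"
  have r: "strict_mono r" "\<And>n. r n \<in> \<iota> ` \<G>"
    using \<open>infinite (\<iota> ` \<G>)\<close> unfolding r_def by (simp_all add: strict_mono_enumerate enumerate_in_set)
  have "\<exists>u\<in>\<G>. \<iota> u = r n" for n using r(2)[of n] by (elim imageE) auto
  then obtain g where g: "\<And>n. g n \<in> \<G>" "\<And>n. \<iota> (g n) = r n" by metis
  have injg: "inj g"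
  proof (rule injI)
    fix m n assume "g m = g n"
    then have "r m = r n" using g(2)[of m] g(2)[of n] by simp
    then show "m = n" using r(1) by (simp add: strict_mono_eq)
  qed
  have "\<forall>\<^sub>F n in sequentially. y \<in> \<nu> (g n)" if "y \<in> topspace Y" for y
  proof -
    have "finite {u \<in> \<G>. y \<notin> u}" using \<G>(2) that unfolding gamma_cover_def by blast
    then have "finite (g -` {u \<in> \<G>. y \<notin> u})" by (rule finite_vimageI[OF _ injg])
    then have "finite {n. y \<notin> \<nu> (g n)}"
    proof (rule rev_finite_subset)
      show "{n. y \<notin> \<nu> (g n)} \<subseteq> g -` {u \<in> \<G>. y \<notin> u}" using g(1) \<iota>[OF g(1)] by fastforce
    qed
    then show ?thesis by (simp flip: cofinite_eq_sequentially add: eventually_cofinite)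
  qed
  moreover have "\<nu> (g n) \<in> \<V> (r n)" for n using \<iota>[OF g(1)] g(2) by simp
  ultimately show ?thesis using r(1) by (intro exI[of _ r] exI[of _ "\<lambda>n. \<nu> (g n)"]) simp
qed

section \<open>Gaps and towers\<close>

lemma topspace_cantor_pow [simp]: "topspace cantor_pow = Pow {1..}"
  by (auto simp: cantor_pow_def topspace_pullback_topology)

lemma openin_cantor_pow_mem:
  assumes "n \<ge> 1"
  shows "openin cantor_pow {a \<in> Pow {1..}. n \<in> a}" "openin cantor_pow {a \<in> Pow {1..}. n \<notin> a}"
proof -
  let ?P = "product_topology (\<lambda>_. discrete_topology (UNIV :: bool set)) {1::nat..}"
  have *: "openin cantor_pow {a \<in> Pow {1..}. (n \<in> a) = b}" for b
  proof -
    have "openin ?P {x \<in> topspace ?P. x n \<in> {b}}"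
      using assms by (intro openin_continuous_map_preimage[OF continuous_map_product_projection]) auto
    then show ?thesis
      unfolding cantor_pow_def openin_pullback_topology
      by (intro exI[of _ "{x \<in> topspace ?P. x n \<in> {b}}"]) (use assms in auto)
  qed
  show "openin cantor_pow {a \<in> Pow {1..}. n \<in> a}" "openin cantor_pow {a \<in> Pow {1..}. n \<notin> a}"
    using *[of True] *[of False] by simp_all
qed

text \<open>A basic open set of the product restricts finitely many coordinates, and
  \<open>e\<close> bounds them all.\<close>

lemma openin_cantor_pow_initial_segment:
  assumes "openin (subtopology cantor_pow A) U" "a \<in> U"
  shows "\<exists>e. \<forall>b\<in>topspace (subtopology cantor_pow A). b \<inter> {..<e} = a \<inter> {..<e} \<longrightarrow> b \<in> U"
proof -
  let ?c = "\<lambda>a. \<lambda>n\<in>{1::nat..}. n \<in> a"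
  obtain W where W: "openin (product_topology (\<lambda>_. discrete_topology (UNIV :: bool set)) {1::nat..}) W"
    "U = (?c -` W \<inter> Pow {1..}) \<inter> A"
    using assms(1) unfolding openin_subtopology cantor_pow_def openin_pullback_topology by blast
  then have "?c a \<in> W" using assms(2) by blast
  then obtain S where S: "finite {i \<in> {1::nat..}. S i \<noteq> (UNIV :: bool set)}"
    "?c a \<in> Pi\<^sub>E {1..} S" "Pi\<^sub>E {1..} S \<subseteq> W"
    using W(1) unfolding openin_product_topology_alt by force
  then obtain e where e: "\<And>i. \<lbrakk>i \<ge> 1; S i \<noteq> UNIV\<rbrakk> \<Longrightarrow> i < e"
    by (metis (mono_tags, lifting) atLeast_iff finite_nat_set_iff_bounded mem_Collect_eq)
  have "b \<in> U" if b: "b \<in> topspace (subtopology cantor_pow A)" "b \<inter> {..<e} = a \<inter> {..<e}" for b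
  proof -
    have "?c b \<in> Pi\<^sub>E {1..} S"
    proof (rule PiE_I)
      fix i :: nat assume i: "i \<in> {1..}"
      show "?c b i \<in> S i"
      proof (cases "S i = UNIV")
        case False
        then have "i < e" using e i by simp
        then have "(i \<in> b) = (i \<in> a)" using b(2) by blast
        then have "?c b i = ?c a i" using i by simp
        then show ?thesis using PiE_mem[OF S(2) i] by (simp only:)
      qed simp
    qed simp
    then have "?c b \<in> W" by (rule subsetD[OF S(3)])
    moreover have "b \<in> Pow {1..}" "b \<in> A" using b(1) by auto
    ultimately show ?thesis unfolding W(2) by simp
  qed
  then show ?thesis by blast
qed

text \<open>The index set is arbitrary, not an initial segment, because the induction removes an
  arbitrary factor.\<close>

definition tower_space :: "(nat \<Rightarrow> nat set set) \<Rightarrow> nat set \<Rightarrow> 'y topology \<Rightarrow> ((nat \<Rightarrow> nat set) \<times> 'y) topology" where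
  "tower_space A I Y = prod_topology (product_topology (\<lambda>i. subtopology cantor_pow (A i)) I) Y"

lemma topspace_tower_space:
  "topspace (tower_space A I Y) = (\<Pi>\<^sub>E i\<in>I. Pow {1..} \<inter> A i) \<times> topspace Y"
  by (simp add: tower_space_def)

lemma openin_tower_space_box:
  assumes "openin (tower_space A I Y) U" "(x, y) \<in> U" "finite I"
  shows "\<exists>e V. openin Y V \<and> y \<in> V \<and>
    (\<forall>z\<in>(\<Pi>\<^sub>E i\<in>I. Pow {1..} \<inter> A i). \<forall>v\<in>V. (\<forall>i\<in>I. z i \<inter> {..<e} = x i \<inter> {..<e}) \<longrightarrow> (z, v) \<in> U)"
proof -
  let ?P = "product_topology (\<lambda>i. subtopology cantor_pow (A i)) I"
  obtain W V where WV: "openin ?P W" "openin Y V" "x \<in> W" "y \<in> V" "W \<times> V \<subseteq> U"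
    using assms(1)[unfolded tower_space_def openin_prod_topology_alt, rule_format, OF assms(2)]
    by (elim exE conjE) (rule that)
  obtain S where S: "\<And>i. i \<in> I \<Longrightarrow> openin (subtopology cantor_pow (A i)) (S i)"
    "x \<in> Pi\<^sub>E I S" "Pi\<^sub>E I S \<subseteq> W"
    using bspec[OF WV(1)[unfolded openin_product_topology_alt] WV(3)] by auto
  have "\<forall>i\<in>I. \<exists>e. \<forall>b\<in>topspace (subtopology cantor_pow (A i)). b \<inter> {..<e} = x i \<inter> {..<e} \<longrightarrow> b \<in> S i"
  proof
    fix i assume i: "i \<in> I"
    show "\<exists>e. \<forall>b\<in>topspace (subtopology cantor_pow (A i)). b \<inter> {..<e} = x i \<inter> {..<e} \<longrightarrow> b \<in> S i"
      by (rule openin_cantor_pow_initial_segment[OF S(1)[OF i] PiE_mem[OF S(2) i]])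
  qed
  then obtain e where e: "\<And>i b. \<lbrakk>i \<in> I; b \<in> topspace (subtopology cantor_pow (A i));
      b \<inter> {..<e i} = x i \<inter> {..<e i}\<rbrakk> \<Longrightarrow> b \<in> S i" by metis
  define e' where "e' = Max (insert 0 (e ` I))"
  have e': "e i \<le> e'" if "i \<in> I" for i
    unfolding e'_def using assms(3) that by (intro Max_ge) auto
  have "(z, v) \<in> U" if z: "z \<in> (\<Pi>\<^sub>E i\<in>I. Pow {1..} \<inter> A i)" and "v \<in> V"
    and eq: "\<forall>i\<in>I. z i \<inter> {..<e'} = x i \<inter> {..<e'}" for z v
  proof -
    have "z \<in> Pi\<^sub>E I S"
    proof (rule PiE_I)
      fix i assume i: "i \<in> I"
      have "z i \<inter> {..<e i} = (z i \<inter> {..<e'}) \<inter> {..<e i}" using e'[OF i] by auto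
      also have "\<dots> = x i \<inter> {..<e i}" using eq i e'[OF i] by auto
      finally show "z i \<in> S i" using e[OF i] z i by (force simp: PiE_iff)
    qed (rule PiE_arb[OF z])
    then have "(z, v) \<in> W \<times> V" using S(3) \<open>v \<in> V\<close> by auto
    then show ?thesis by (rule subsetD[OF WV(5)])
  qed
  then show ?thesis using WV(2,4) by (intro exI[of _ e'] exI[of _ V]) simp
qed

text \<open>A point with the gap agrees below \<open>e\<close> with its truncation to numbers below
  \<open>n\<close>. There are only finitely many truncated tuples, and finitely many points in
  \<open>F\<close>, so one \<open>e\<close> and one open set \<open>V\<close> suit them all.\<close>

lemma tower_space_common_gap:
  fixes U :: "((nat \<Rightarrow> nat set) \<times> 'y) set"
  assumes U: "openin (tower_space A I Y) U" and I: "finite I"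
    and F: "finite F" "F \<subseteq> topspace Y"
    and sub: "(\<Pi>\<^sub>E i\<in>I. Pow {1..<n}) \<times> F \<subseteq> U"
  shows "\<exists>V e. openin Y V \<and> F \<subseteq> V \<and>
    (\<forall>x\<in>(\<Pi>\<^sub>E i\<in>I. Pow {1..} \<inter> A i). \<forall>y\<in>V. (\<forall>i\<in>I. x i \<inter> {n..<e} = {}) \<longrightarrow> (x, y) \<in> U)"
proof -
  let ?B = "\<Pi>\<^sub>E i\<in>I. Pow {1..<n}"
  have finB: "finite ?B" using I by (intro finite_PiE) auto
  have "\<forall>p\<in>?B \<times> F. \<exists>e V. openin Y V \<and> snd p \<in> V \<and>
    (\<forall>z\<in>(\<Pi>\<^sub>E i\<in>I. Pow {1..} \<inter> A i). \<forall>v\<in>V.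
       (\<forall>i\<in>I. z i \<inter> {..<e} = fst p i \<inter> {..<e}) \<longrightarrow> (z, v) \<in> U)"
    using sub by (intro ballI openin_tower_space_box[OF U _ I]) auto
  then obtain e V where eV: "\<And>p. p \<in> ?B \<times> F \<Longrightarrow> openin Y (V p) \<and> snd p \<in> V p \<and>
    (\<forall>z\<in>(\<Pi>\<^sub>E i\<in>I. Pow {1..} \<inter> A i). \<forall>v\<in>V p.
       (\<forall>i\<in>I. z i \<inter> {..<e p} = fst p i \<inter> {..<e p}) \<longrightarrow> (z, v) \<in> U)"
    by metis
  \<comment> \<open>The inserted 0 keeps the maximum defined when \<open>F\<close> is empty.\<close>
  define e' where "e' = Max (insert 0 (e ` (?B \<times> F)))"
  have e': "e p \<le> e'" if "p \<in> ?B \<times> F" for p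
    unfolding e'_def using finB F(1) that by (intro Max_ge) auto
  define V' where "V' = (\<Union>y\<in>F. \<Inter>s\<in>?B. V (s, y))"
  \<comment> \<open>A nonempty index set is what makes the finite intersection in \<open>V'\<close>
    open.\<close>
  have "(\<lambda>i\<in>I. {}) \<in> ?B" by auto
  then have ne: "?B \<noteq> {}" by blast
  have "openin Y V'"
    unfolding V'_def using finB ne eV by (intro openin_Union openin_INT2 ballI imageI) auto
  moreover have "F \<subseteq> V'"
  proof
    fix y assume y: "y \<in> F"
    have "y \<in> V (s, y)" if "s \<in> ?B" for s using eV[of "(s, y)"] that y by simp
    then show "y \<in> V'" unfolding V'_def using y by blast
  qed
  moreover have "(x, y) \<in> U" if x: "x \<in> (\<Pi>\<^sub>E i\<in>I. Pow {1..} \<inter> A i)" and y: "y \<in> V'"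
    and gap: "\<forall>i\<in>I. x i \<inter> {n..<e'} = {}" for x y
  proof -
    obtain y0 where y0: "y0 \<in> F" "\<And>s. s \<in> ?B \<Longrightarrow> y \<in> V (s, y0)"
      using y unfolding V'_def by blast
    define s where "s = (\<lambda>i\<in>I. x i \<inter> {1..<n})"
    have s: "s \<in> ?B" unfolding s_def by auto
    have "x i \<inter> {..<e (s, y0)} = fst (s, y0) i \<inter> {..<e (s, y0)}" if i: "i \<in> I" for i
    proof -
      have "x i \<subseteq> {1..}" using x i by (auto simp: PiE_iff)
      moreover have "x i \<inter> {n..<e (s, y0)} = {}" using gap i e'[of "(s, y0)"] s y0(1) by fastforce
      ultimately show ?thesis using i unfolding s_def by force
    qed
    then show ?thesis using eV[of "(s, y0)"] s y0 x by auto
  qed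
  ultimately show ?thesis by (intro exI[of _ V'] exI[of _ e']) simp
qed

section \<open>Thinning a sequence of gaps by the tower property\<close>

text \<open>The tower property is applied to the set of all \<open>a n\<close> with \<open>n\<close>
  in \<open>B\<close>. An interval between consecutive elements of that set begins at some
  \<open>a n\<close> and contains the whole of \<open>{a n..<a (Suc n)}\<close>; the new index set
  collects these \<open>n\<close>.\<close>

lemma tower_intervals:
  assumes X: "generalized_tower \<kappa> X" and a: "strict_mono a" "\<And>n. 1 \<le> a n" and B: "infinite B"
  shows "\<exists>B'\<subseteq>B. infinite B' \<and> (\<exists>S\<subseteq>X. |S| <o \<kappa> \<and>
    (\<forall>x\<in>X - S. finite {n \<in> B'. x \<inter> {a n..<a (Suc n)} \<noteq> {}}))"
proof -
  have inf: "infinite (a ` B)" using B a(1) by (simp add: finite_image_iff strict_mono_imp_inj_on)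
  then have "a ` B \<in> inf_subsets" using a(2) unfolding inf_subsets_def by auto
  then obtain b S where b: "b \<in> inf_subsets" "S \<subseteq> X" "|S| <o \<kappa>"
    "\<And>x. x \<in> X - S \<Longrightarrow> finite (x \<inter> (\<Union>n\<in>b. {enum1 (a ` B) n..<enum1 (a ` B) (n + 1)}))"
    using X unfolding generalized_tower_def by meson
  have "enum1 (a ` B) n \<in> a ` B" for n
    unfolding enum1_def using inf by (rule enumerate_in_set)
  then have "\<forall>n. \<exists>m\<in>B. enum1 (a ` B) n = a m" by blast
  then obtain c where c: "\<And>n. c n \<in> B" "\<And>n. enum1 (a ` B) n = a (c n)" by metis
  have c_less: "c n < c (n + 1)" if "n \<in> b" for n
  proof -
    \<comment> \<open>\<open>enum1\<close> agrees at 0 and 1, so it increases strictly only from 1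
      on; this is where \<open>b\<close> being a set of positive numbers matters.\<close>
    have "n \<ge> 1" using b(1) that unfolding inf_subsets_def by auto
    then have "enum1 (a ` B) n < enum1 (a ` B) (n + 1)"
      unfolding enum1_def using enumerate_step[OF inf, of "n - 1"] by simp
    then show ?thesis using c(2) a(1) by (metis strict_mono_less)
  qed
  have "inj_on c b"
  proof (rule inj_onI)
    fix n n' assume n: "n \<in> b" "n' \<in> b" and "c n = c n'"
    then have "enumerate (a ` B) (n - 1) = enumerate (a ` B) (n' - 1)"
      using c(2) unfolding enum1_def by metis
    then have "n - 1 = n' - 1" using inf by (metis strict_mono_enumerate strict_mono_eq)
    moreover have "n \<ge> 1" "n' \<ge> 1" using b(1) n unfolding inf_subsets_def by auto
    ultimately show "n = n'" by linarith
  qed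
  then have "infinite (c ` b)" using b(1) unfolding inf_subsets_def by (simp add: finite_image_iff)
  moreover have "finite {n \<in> c ` b. x \<inter> {a n..<a (Suc n)} \<noteq> {}}" if x: "x \<in> X - S" for x
  proof -
    obtain M where M: "\<And>i. i \<in> x \<inter> (\<Union>n\<in>b. {enum1 (a ` B) n..<enum1 (a ` B) (n + 1)}) \<Longrightarrow> i < M"
      using b(4)[OF x] by (metis finite_nat_set_iff_bounded)
    have "n < M" if n: "n \<in> c ` b" "x \<inter> {a n..<a (Suc n)} \<noteq> {}" for n
    proof -
      obtain m where m: "m \<in> b" "n = c m" using n(1) by blast
      obtain i where i: "i \<in> x" "a n \<le> i" "i < a (Suc n)" using n(2) by auto
      \<comment> \<open>The short interval starting at \<open>a n\<close> lies inside the interval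
        of the enumeration with number \<open>m\<close>, so \<open>i\<close> is one of the finitely
        many points bounded by \<open>M\<close>.\<close>
      have "a (Suc n) \<le> a (c (m + 1))"
        using c_less[OF m(1)] m(2) a(1) by (simp add: strict_mono_less_eq)
      then have "i < M" using i m by (intro M) (auto simp: c(2) intro!: bexI[of _ m])
      then show ?thesis using i(2) strict_mono_imp_increasing[OF a(1), of n] by linarith
    qed
    then show ?thesis using finite_nat_set_iff_bounded by auto
  qed
  moreover have "c ` b \<subseteq> B" using c(1) by blast
  ultimately show ?thesis using b(2,3) by meson
qed

text \<open>The towers are treated one after another, each inside the index set left by the previous
  ones; shrinking the index set preserves finiteness already obtained.\<close>

lemma towers_intervals:
  assumes "finite I" and X: "\<And>l. l \<in> I \<Longrightarrow> generalized_tower \<kappa> (X l)"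
    and a: "strict_mono a" "\<And>n. 1 \<le> a n"
  shows "\<exists>B S. infinite B \<and> (\<forall>l\<in>I. S l \<subseteq> X l \<and> |S l| <o \<kappa> \<and>
    (\<forall>x\<in>X l - S l. finite {n \<in> B. x \<inter> {a n..<a (Suc n)} \<noteq> {}}))"
  using assms(1,2)
proof (induction I)
  case empty
  then show ?case using infinite_UNIV_nat by blast
next
  case (insert l I)
  have "\<exists>B S. infinite B \<and> (\<forall>l\<in>I. S l \<subseteq> X l \<and> |S l| <o \<kappa> \<and>
    (\<forall>x\<in>X l - S l. finite {n \<in> B. x \<inter> {a n..<a (Suc n)} \<noteq> {}}))"
    by (rule insert.IH) (rule insert.prems, rule insertI2)
  then obtain B S where B: "infinite B" and S: "\<And>l. l \<in> I \<Longrightarrow> S l \<subseteq> X l \<and> |S l| <o \<kappa> \<and>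
    (\<forall>x\<in>X l - S l. finite {n \<in> B. x \<inter> {a n..<a (Suc n)} \<noteq> {}})" by (elim exE conjE) (blast intro: that)
  obtain B' R where B': "B' \<subseteq> B" "infinite B'" and R: "R \<subseteq> X l" "|R| <o \<kappa>"
    "\<forall>x\<in>X l - R. finite {n \<in> B'. x \<inter> {a n..<a (Suc n)} \<noteq> {}}"
    using tower_intervals[OF insert.prems[of l] a B] by blast
  have "finite {n \<in> B'. x \<inter> {a n..<a (Suc n)} \<noteq> {}}" if "k \<in> I" "x \<in> X k - S k" for k x
  proof (rule finite_subset)
    show "finite {n \<in> B. x \<inter> {a n..<a (Suc n)} \<noteq> {}}" using S[OF that(1)] that(2) by simp
    show "{n \<in> B'. x \<inter> {a n..<a (Suc n)} \<noteq> {}} \<subseteq> {n \<in> B. x \<inter> {a n..<a (Suc n)} \<noteq> {}}"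
      using B'(1) by auto
  qed
  moreover have "k \<noteq> l" if "k \<in> I" for k using insert.hyps(2) that by blast
  ultimately have "\<forall>k\<in>insert l I. (S(l := R)) k \<subseteq> X k \<and> |(S(l := R)) k| <o \<kappa> \<and>
    (\<forall>x\<in>X k - (S(l := R)) k. finite {n \<in> B'. x \<inter> {a n..<a (Suc n)} \<noteq> {}})"
    using R S by simp
  then show ?case by (intro exI[of _ B'] exI[of _ "S(l := R)"] conjI B'(2))
qed

section \<open>Zero-dimensional sets of reals\<close>

lemma abs_suminf_ternary_tail_le:
  fixes d :: "nat \<Rightarrow> real"
  assumes "\<And>n. \<bar>d n\<bar> \<le> 1"
  shows "\<bar>\<Sum>n. d (n + M) * (1/3) ^ (n + M)\<bar> \<le> 3/2 * (1/3) ^ M"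
proof -
  have le: "norm (d (n + M) * (1/3) ^ (n + M)) \<le> (1/3) ^ M * (1/3) ^ n" for n
    using assms[of "n + M"] by (simp add: abs_mult power_add)
  have s: "(\<lambda>n. (1/3) ^ M * (1/3) ^ n :: real) sums ((1/3) ^ M * (1 / (1 - 1/3)))"
    by (intro sums_mult geometric_sums) simp
  have "norm (\<Sum>n. d (n + M) * (1/3) ^ (n + M)) \<le> (\<Sum>n. (1/3) ^ M * (1/3) ^ n)"
    by (rule norm_suminf_le[OF le sums_summable[OF s]])
  also have "\<dots> = 3/2 * (1/3) ^ M" using sums_unique[OF s] by simp
  finally show ?thesis by simp
qed

text \<open>Up to the factor 3/2, the usual homeomorphism from 0-1 sequences onto the Cantor ternary
  set.\<close>

definition ternary :: "(nat \<Rightarrow> bool) \<Rightarrow> real" where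
  "ternary \<beta> = (\<Sum>n. of_bool (\<beta> n) * (1/3) ^ n)"

lemma ternary_diff:
  assumes "\<forall>n<M. \<beta> n = \<beta>' n"
  shows "ternary \<beta> - ternary \<beta>' =
    (\<Sum>n. (of_bool (\<beta> (n + M)) - of_bool (\<beta>' (n + M))) * (1/3) ^ (n + M))"
proof -
  have sm: "summable (\<lambda>n. of_bool (\<beta> n) * (1/3) ^ n :: real)" for \<beta> :: "nat \<Rightarrow> bool"
    by (rule summable_comparison_test'[of "\<lambda>n. (1/3) ^ n" 0]) (auto simp: summable_geometric)
  have eq: "(\<Sum>n. of_bool (\<beta> n) * (1/3) ^ n - of_bool (\<beta>' n) * (1/3) ^ n :: real) = ternary \<beta> - ternary \<beta>'"
    unfolding ternary_def by (rule suminf_diff[OF sm sm, symmetric])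
  have sm': "summable (\<lambda>n. of_bool (\<beta> n) * (1/3) ^ n - of_bool (\<beta>' n) * (1/3) ^ n :: real)"
    by (intro summable_diff sm)
  from suminf_split_initial_segment[OF sm', of M] show ?thesis
    unfolding eq using assms by (simp add: left_diff_distrib)
qed

lemma ternary_close:
  assumes "\<forall>n<M. \<beta> n = \<beta>' n"
  shows "\<bar>ternary \<beta> - ternary \<beta>'\<bar> \<le> 3/2 * (1/3) ^ M"
  unfolding ternary_diff[OF assms]
  by (rule abs_suminf_ternary_tail_le[of "\<lambda>n. of_bool (\<beta> n) - of_bool (\<beta>' n)"]) simp

text \<open>At the first difference \<open>k\<close> the leading term has size
  \<open>(1/3) ^ k\<close>, while the tail is at most half of that. In base 2 the tail could cancel
  the leading term.\<close>

lemma ternary_separated: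
  assumes "\<bar>ternary \<beta> - ternary \<beta>'\<bar> < (1/3) ^ M / 2" and "n \<le> M"
  shows "\<beta> n = \<beta>' n"
proof (rule ccontr)
  assume ne: "\<beta> n \<noteq> \<beta>' n"
  define k where "k = (LEAST n. \<beta> n \<noteq> \<beta>' n)"
  have k: "\<beta> k \<noteq> \<beta>' k" "k \<le> n" "\<forall>i<k. \<beta> i = \<beta>' i"
    unfolding k_def using LeastI[of "\<lambda>n. \<beta> n \<noteq> \<beta>' n", OF ne] Least_le[of "\<lambda>n. \<beta> n \<noteq> \<beta>' n", OF ne]
      not_less_Least by blast+
  define d :: "nat \<Rightarrow> real" where "d i = of_bool (\<beta> i) - of_bool (\<beta>' i)" for i
  have d1: "\<bar>d i\<bar> \<le> 1" for i unfolding d_def by simp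
  have "summable (\<lambda>i. d (i + k) * (1/3) ^ (i + k))"
    by (rule summable_comparison_test'[of "\<lambda>n. (1/3) ^ n * (1/3) ^ k" 0])
      (use d1 in \<open>auto simp: summable_geometric abs_mult power_add summable_mult2\<close>)
  from suminf_split_head[OF this]
  have "ternary \<beta> - ternary \<beta>' = d k * (1/3) ^ k + (\<Sum>i. d (i + Suc k) * (1/3) ^ (i + Suc k))"
    using ternary_diff[OF k(3)] unfolding d_def by simp
  moreover have "\<bar>\<Sum>i. d (i + Suc k) * (1/3) ^ (i + Suc k)\<bar> \<le> 3/2 * (1/3) ^ Suc k"
    by (rule abs_suminf_ternary_tail_le) (rule d1)
  moreover have "\<bar>d k * (1/3) ^ k\<bar> = (1/3) ^ k" using k(1) unfolding d_def by (auto simp: abs_mult)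
  moreover have "(1/3 :: real) ^ M \<le> (1/3) ^ k" using k(2) assms(2) by (intro power_decreasing) auto
  moreover have "3/2 * (1/3 :: real) ^ Suc k = (1/3) ^ k / 2" by simp
  ultimately show False using assms(1) by linarith
qed

section \<open>Countable families of clopen sets that code points\<close>

text \<open>Membership in the sets of \<open>\<C>\<close> codes points by 0-1 sequences. The last
  two clauses say that the coding is injective with continuous inverse; using finite patterns
  instead of a base spares closing \<open>\<C>\<close> under intersections.\<close>

definition clopen_coding :: "'a topology \<Rightarrow> 'a set set \<Rightarrow> bool" where
  "clopen_coding T \<C> \<longleftrightarrow> countable \<C> \<and> (\<forall>C\<in>\<C>. openin T C \<and> closedin T C) \<and>
     (\<forall>x\<in>topspace T. \<forall>z\<in>topspace T. (\<forall>C\<in>\<C>. x \<in> C \<longleftrightarrow> z \<in> C) \<longrightarrow> x = z) \<and>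
     (\<forall>U. openin T U \<longrightarrow> (\<forall>x\<in>U. \<exists>F\<subseteq>\<C>. finite F \<and>
        (\<forall>z\<in>topspace T. (\<forall>C\<in>F. x \<in> C \<longleftrightarrow> z \<in> C) \<longrightarrow> z \<in> U)))"

lemma clopen_codingD:
  assumes "clopen_coding T \<C>"
  shows "countable \<C>" "C \<in> \<C> \<Longrightarrow> openin T C" "C \<in> \<C> \<Longrightarrow> closedin T C"
    "\<lbrakk>x \<in> topspace T; z \<in> topspace T; \<And>C. C \<in> \<C> \<Longrightarrow> x \<in> C \<longleftrightarrow> z \<in> C\<rbrakk> \<Longrightarrow> x = z"
    "\<lbrakk>openin T U; x \<in> U\<rbrakk> \<Longrightarrow> \<exists>F\<subseteq>\<C>. finite F \<and>
        (\<forall>z\<in>topspace T. (\<forall>C\<in>F. x \<in> C \<longleftrightarrow> z \<in> C) \<longrightarrow> z \<in> U)"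
proof -
  note * = assms[unfolded clopen_coding_def]
  show "countable \<C>" "C \<in> \<C> \<Longrightarrow> openin T C" "C \<in> \<C> \<Longrightarrow> closedin T C" using * by blast+
  show "x = z" if "x \<in> topspace T" "z \<in> topspace T" "\<And>C. C \<in> \<C> \<Longrightarrow> x \<in> C \<longleftrightarrow> z \<in> C"
    by (rule *[THEN conjunct2, THEN conjunct2, THEN conjunct1, THEN bspec, THEN bspec, THEN mp, OF that(1,2)])
      (rule ballI, rule that(3))
  show "\<exists>F\<subseteq>\<C>. finite F \<and> (\<forall>z\<in>topspace T. (\<forall>C\<in>F. x \<in> C \<longleftrightarrow> z \<in> C) \<longrightarrow> z \<in> U)"
    if "openin T U" "x \<in> U"
    by (rule *[THEN conjunct2, THEN conjunct2, THEN conjunct2, THEN spec, THEN mp, THEN bspec, OF that])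
qed

lemma clopen_codingI:
  assumes "countable \<C>" "\<And>C. C \<in> \<C> \<Longrightarrow> openin T C" "\<And>C. C \<in> \<C> \<Longrightarrow> closedin T C"
    "\<And>x z. \<lbrakk>x \<in> topspace T; z \<in> topspace T; \<And>C. C \<in> \<C> \<Longrightarrow> x \<in> C \<longleftrightarrow> z \<in> C\<rbrakk> \<Longrightarrow> x = z"
    "\<And>U x. \<lbrakk>openin T U; x \<in> U\<rbrakk> \<Longrightarrow> \<exists>F\<subseteq>\<C>. finite F \<and>
        (\<forall>z\<in>topspace T. (\<forall>C\<in>F. x \<in> C \<longleftrightarrow> z \<in> C) \<longrightarrow> z \<in> U)"
  shows "clopen_coding T \<C>"
  unfolding clopen_coding_def
proof (intro conjI ballI allI impI)
  show "x = z" if "x \<in> topspace T" "z \<in> topspace T" "\<forall>C\<in>\<C>. x \<in> C \<longleftrightarrow> z \<in> C" for x z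
    by (rule assms(4)[OF that(1,2)]) (rule bspec[OF that(3)])
qed (fact assms)+

text \<open>The membership pattern of a point, read as a ternary series, is a real number. Values
  are close exactly when long initial parts of the patterns agree, so this map is a homeomorphism
  onto its image.\<close>

lemma clopen_coding_imp_set_of_reals:
  assumes \<C>: "clopen_coding T \<C>"
  shows "set_of_reals T"
proof -
  \<comment> \<open>Adding the empty set, which is clopen, allows an enumeration even if
    \<open>\<C>\<close> is empty.\<close>
  obtain c :: "nat \<Rightarrow> 'a set" where c: "range c = insert {} \<C>"
    using uncountable_def[of "insert {} \<C>"] clopen_codingD(1)[OF \<C>] by auto
  have clopen: "openin T (c n)" "closedin T (c n)" for n
  proof -
    have "c n \<in> insert {} \<C>" using c by blast
    then show "openin T (c n)" "closedin T (c n)" using clopen_codingD(2,3)[OF \<C>] by auto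
  qed
  define g where "g x = ternary (\<lambda>n. x \<in> c n)" for x
  have inj: "inj_on g (topspace T)"
  proof (rule inj_onI)
    fix x z assume xz: "x \<in> topspace T" "z \<in> topspace T" "g x = g z"
    have agree: "(x \<in> c n) = (z \<in> c n)" for n
      by (rule ternary_separated[where M = n]) (use xz(3) in \<open>simp_all add: g_def\<close>)
    show "x = z"
    proof (rule clopen_codingD(4)[OF \<C> xz(1,2)])
      fix C assume "C \<in> \<C>"
      then obtain n where "C = c n" using c by (metis insertCI rangeE)
      then show "(x \<in> C) = (z \<in> C)" using agree by simp
    qed
  qed
  have cont: "continuous_map T euclideanreal g"
    unfolding continuous_map_def
  proof (intro conjI allI impI)
    fix W :: "real set" assume "openin euclideanreal W"
    then have W: "open W" by simp
    show "openin T {x \<in> topspace T. g x \<in> W}"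
    proof (subst openin_subopen, intro ballI)
      fix x assume x: "x \<in> {x \<in> topspace T. g x \<in> W}"
      then obtain \<epsilon> where \<epsilon>: "\<epsilon> > 0" "\<And>t. \<bar>t - g x\<bar> < \<epsilon> \<Longrightarrow> t \<in> W"
        using W unfolding open_dist dist_real_def by blast
      obtain M where M: "(1/3 :: real) ^ M < \<epsilon> / 2"
        using real_arch_pow_inv[of "\<epsilon> / 2" "1/3"] \<epsilon>(1) by auto
      \<comment> \<open>The points with the same first \<open>M\<close> membership answers as
        \<open>x\<close>.\<close>
      define N where "N = topspace T \<inter> (\<Inter>n\<in>{..<M}. if x \<in> c n then c n else topspace T - c n)"
      have "openin T N"
      proof (cases "M = 0")
        case False
        then show ?thesis unfolding N_def using clopen
          by (intro openin_Int openin_INT2) auto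
      qed (simp add: N_def)
      moreover have "x \<in> N" using x unfolding N_def by auto
      moreover have "N \<subseteq> {x \<in> topspace T. g x \<in> W}"
      proof
        fix z assume z: "z \<in> N"
        then have "\<forall>n<M. (z \<in> c n) = (x \<in> c n)" unfolding N_def by (auto split: if_splits)
        then have "\<bar>g z - g x\<bar> \<le> 3/2 * (1/3) ^ M" unfolding g_def by (rule ternary_close)
        then have "\<bar>g z - g x\<bar> < \<epsilon>" using M \<epsilon>(1) by linarith
        then show "z \<in> {x \<in> topspace T. g x \<in> W}" using \<epsilon>(2) z unfolding N_def by auto
      qed
      ultimately show "\<exists>N. openin T N \<and> x \<in> N \<and> N \<subseteq> {x \<in> topspace T. g x \<in> W}" by blast
    qed
  qed simp
  have "open_map T (top_of_set (g ` topspace T)) g"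
    unfolding open_map_def
  proof (intro allI impI)
    fix U assume U: "openin T U"
    then have sub: "U \<subseteq> topspace T" by (rule openin_subset)
    show "openin (top_of_set (g ` topspace T)) (g ` U)"
      unfolding openin_euclidean_subtopology_iff
    proof (intro conjI ballI)
      fix t assume "t \<in> g ` U"
      then obtain x where x: "x \<in> U" "t = g x" by blast
      obtain F where F: "F \<subseteq> \<C>" "finite F"
        "\<forall>z\<in>topspace T. (\<forall>C\<in>F. x \<in> C \<longleftrightarrow> z \<in> C) \<longrightarrow> z \<in> U"
        using clopen_codingD(5)[OF \<C> U x(1)] by (elim exE conjE) (rule that)
      have "F \<subseteq> range c" using F(1) c by blast
      then obtain N where N: "finite N" "F = c ` N" using F(2) finite_subset_image[of F c UNIV] by blast
      then obtain M where M: "\<And>n. n \<in> N \<Longrightarrow> n \<le> M" by (metis Max_ge)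
      have "t' \<in> g ` U" if t': "t' \<in> g ` topspace T" "dist t' t < (1/3) ^ M / 2" for t'
      proof -
        obtain z where z: "z \<in> topspace T" "t' = g z" using t'(1) by blast
        have "(z \<in> c n) = (x \<in> c n)" if "n \<le> M" for n
          by (rule ternary_separated[OF _ that])
            (use t'(2) x(2) z(2) in \<open>simp add: g_def dist_real_def\<close>)
        then have "z \<in> U" using N(2) M by (intro F(3)[THEN bspec, OF z(1), THEN mp]) auto
        then show ?thesis using z(2) by blast
      qed
      then show "\<exists>e>0. \<forall>x'\<in>g ` topspace T. dist x' t < e \<longrightarrow> x' \<in> g ` U"
        by (intro exI[of _ "(1/3) ^ M / 2"]) simp
    qed (use sub in blast)
  qed
  moreover have "continuous_map T (top_of_set (g ` topspace T)) g"
    using cont by (simp add: continuous_map_in_subtopology)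
  ultimately have "homeomorphic_map T (top_of_set (g ` topspace T)) g"
    using inj by (intro bijective_open_imp_homeomorphic_map) auto
  then show ?thesis
    unfolding set_of_reals_def by (blast intro: homeomorphic_map_imp_homeomorphic_space)
qed

text \<open>The family consists of the sets of all points containing a given
  \<open>n \<ge> 1\<close>; finitely many of them fix an initial segment.\<close>

lemma clopen_coding_cantor_pow:
  "\<exists>\<C>. clopen_coding (subtopology cantor_pow A) \<C>"
proof -
  let ?T = "subtopology cantor_pow A"
  let ?c = "\<lambda>n. {a \<in> topspace ?T. n \<in> a}"
  have "openin ?T (?c n) \<and> closedin ?T (?c n)" if "n \<ge> 1" for n
  proof
    have "?c n = {a \<in> Pow {1..}. n \<in> a} \<inter> A" by auto
    then show "openin ?T (?c n)"
      using openin_cantor_pow_mem(1)[OF that] unfolding openin_subtopology by blast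
    have "topspace ?T - ?c n = {a \<in> Pow {1..}. n \<notin> a} \<inter> A" by auto
    then have "openin ?T (topspace ?T - ?c n)"
      using openin_cantor_pow_mem(2)[OF that] unfolding openin_subtopology by blast
    then show "closedin ?T (?c n)" unfolding closedin_def by blast
  qed
  moreover have "x = z" if "x \<in> topspace ?T" "z \<in> topspace ?T" "\<forall>C\<in>?c ` {1..}. x \<in> C \<longleftrightarrow> z \<in> C" for x z
  proof -
    have "(n \<in> x) = (n \<in> z)" if "n \<ge> 1" for n
      using \<open>\<forall>C\<in>?c ` {1..}. x \<in> C \<longleftrightarrow> z \<in> C\<close>[THEN bspec, of "?c n"] that
        \<open>x \<in> topspace ?T\<close> \<open>z \<in> topspace ?T\<close> by auto
    moreover have "x \<subseteq> {1..}" "z \<subseteq> {1..}" using that(1,2) by auto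
    ultimately show ?thesis by (metis atLeast_iff subset_antisym subsetD subsetI)
  qed
  moreover have "\<exists>F\<subseteq>?c ` {1..}. finite F \<and> (\<forall>z\<in>topspace ?T. (\<forall>C\<in>F. x \<in> C \<longleftrightarrow> z \<in> C) \<longrightarrow> z \<in> U)"
    if U: "openin ?T U" "x \<in> U" for U x
  proof -
    obtain e where e: "\<forall>b\<in>topspace ?T. b \<inter> {..<e} = x \<inter> {..<e} \<longrightarrow> b \<in> U"
      using openin_cantor_pow_initial_segment[OF U] by blast
    have x: "x \<in> topspace ?T" using U openin_subset by blast
    have "z \<in> U" if z: "z \<in> topspace ?T" "\<forall>C\<in>?c ` {1..<e}. x \<in> C \<longleftrightarrow> z \<in> C" for z
    proof -
      have "(n \<in> z) = (n \<in> x)" if "n < e" for n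
      proof (cases "n = 0")
        \<comment> \<open>The number 0 belongs to no point of the space.\<close>
        case True
        then show ?thesis using x z(1) by auto
      next
        case False
        then have "?c n \<in> ?c ` {1..<e}" using that by (intro imageI) auto
        then show ?thesis using z x by auto
      qed
      then have "z \<inter> {..<e} = x \<inter> {..<e}" by auto
      then show ?thesis using e z(1) by simp
    qed
    then show ?thesis by (intro exI[of _ "?c ` {1..<e}"]) auto
  qed
  ultimately show ?thesis
    unfolding clopen_coding_def by (intro exI[of _ "?c ` {1..}"]) simp
qed

lemma clopen_coding_prod_topology:
  assumes C: "clopen_coding S \<C>" and D: "clopen_coding T \<D>"
  shows "clopen_coding (prod_topology S T)
    ((\<lambda>C. C \<times> topspace T) ` \<C> \<union> (\<lambda>C. topspace S \<times> C) ` \<D>)"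
proof -
  let ?P = "prod_topology S T"
  let ?l = "\<lambda>C. C \<times> topspace T" and ?r = "\<lambda>C. topspace S \<times> C"
  show ?thesis
  proof (rule clopen_codingI)
    show "countable (?l ` \<C> \<union> ?r ` \<D>)" using clopen_codingD(1)[OF C] clopen_codingD(1)[OF D] by simp
    show "openin ?P E" if "E \<in> ?l ` \<C> \<union> ?r ` \<D>" for E
      using that clopen_codingD(2)[OF C] clopen_codingD(2)[OF D] by (auto simp: openin_prod_Times_iff)
    show "closedin ?P E" if "E \<in> ?l ` \<C> \<union> ?r ` \<D>" for E
      using that clopen_codingD(3)[OF C] clopen_codingD(3)[OF D] by (auto simp: closedin_prod_Times_iff)
    show "p = q" if p: "p \<in> topspace ?P" and q: "q \<in> topspace ?P"
      and eq: "\<And>E. E \<in> ?l ` \<C> \<union> ?r ` \<D> \<Longrightarrow> p \<in> E \<longleftrightarrow> q \<in> E" for p q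
    proof (rule prod_eqI)
      show "fst p = fst q"
      proof (rule clopen_codingD(4)[OF C])
        show "(fst p \<in> C) = (fst q \<in> C)" if "C \<in> \<C>" for C
          using eq[of "?l C"] that p q by (auto simp: mem_Times_iff)
      qed (use p q in auto)
      show "snd p = snd q"
      proof (rule clopen_codingD(4)[OF D])
        show "(snd p \<in> C) = (snd q \<in> C)" if "C \<in> \<D>" for C
          using eq[of "?r C"] that p q by (auto simp: mem_Times_iff)
      qed (use p q in auto)
    qed
    show "\<exists>F\<subseteq>?l ` \<C> \<union> ?r ` \<D>. finite F \<and> (\<forall>q\<in>topspace ?P. (\<forall>E\<in>F. p \<in> E \<longleftrightarrow> q \<in> E) \<longrightarrow> q \<in> U)"
      if U: "openin ?P U" "p \<in> U" for U p
    proof -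
      have p: "p \<in> topspace ?P" using U openin_subset by blast
      have pU: "(fst p, snd p) \<in> U" using U(2) by simp
      obtain V W where VW: "openin S V" "openin T W" "fst p \<in> V" "snd p \<in> W" "V \<times> W \<subseteq> U"
        using U(1)[unfolded openin_prod_topology_alt, rule_format, OF pU]
        by (elim exE conjE) (rule that)
      obtain F where F: "F \<subseteq> \<C>" "finite F"
        "\<forall>z\<in>topspace S. (\<forall>C\<in>F. fst p \<in> C \<longleftrightarrow> z \<in> C) \<longrightarrow> z \<in> V"
        using clopen_codingD(5)[OF C VW(1,3)] by (elim exE conjE) (rule that)
      obtain G where G: "G \<subseteq> \<D>" "finite G"
        "\<forall>z\<in>topspace T. (\<forall>C\<in>G. snd p \<in> C \<longleftrightarrow> z \<in> C) \<longrightarrow> z \<in> W"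
        using clopen_codingD(5)[OF D VW(2,4)] by (elim exE conjE) (rule that)
      have "q \<in> U" if q: "q \<in> topspace ?P" "\<forall>E\<in>?l ` F \<union> ?r ` G. p \<in> E \<longleftrightarrow> q \<in> E" for q
      proof -
        have "(fst p \<in> C) = (fst q \<in> C)" if "C \<in> F" for C
          using q(2)[THEN bspec, of "?l C"] that p q(1) by (auto simp: mem_Times_iff)
        then have "fst q \<in> V" using F(3) q(1) by auto
        have "(snd p \<in> C) = (snd q \<in> C)" if "C \<in> G" for C
          using q(2)[THEN bspec, of "?r C"] that p q(1) by (auto simp: mem_Times_iff)
        then have "snd q \<in> W" using G(3) q(1) by auto
        with \<open>fst q \<in> V\<close> have "q \<in> V \<times> W" by (simp add: mem_Times_iff)
        then show ?thesis by (rule subsetD[OF VW(5)])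
      qed
      moreover have "?l ` F \<union> ?r ` G \<subseteq> ?l ` \<C> \<union> ?r ` \<D>" using F(1) G(1) by blast
      ultimately show ?thesis using F(2) G(2)
        by (intro exI[of _ "?l ` F \<union> ?r ` G"] conjI ballI impI) auto
    qed
  qed
qed

lemma clopen_coding_product_topology:
  assumes I: "countable I" and C: "\<And>i. i \<in> I \<Longrightarrow> clopen_coding (T i) (\<C> i)"
  shows "clopen_coding (product_topology T I)
    (\<Union>i\<in>I. (\<lambda>C. {x \<in> topspace (product_topology T I). x i \<in> C}) ` \<C> i)"
proof -
  let ?P = "product_topology T I"
  let ?p = "\<lambda>i C. {x \<in> topspace ?P. x i \<in> C}"
  let ?D = "\<Union>i\<in>I. ?p i ` \<C> i"
  show ?thesis
  proof (rule clopen_codingI)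
    show "countable ?D" using I clopen_codingD(1)[OF C] by auto
    show "openin ?P E" if E: "E \<in> ?D" for E
    proof -
      obtain i C' where "i \<in> I" "C' \<in> \<C> i" "E = ?p i C'"
        using E by (elim UN_E imageE)
      then show ?thesis
        using clopen_codingD(2)[OF C] openin_continuous_map_preimage[OF continuous_map_product_projection[of i I T]] by simp
    qed
    show "closedin ?P E" if E: "E \<in> ?D" for E
    proof -
      obtain i C' where "i \<in> I" "C' \<in> \<C> i" "E = ?p i C'"
        using E by (elim UN_E imageE)
      then show ?thesis
        using clopen_codingD(3)[OF C] closedin_continuous_map_preimage[OF continuous_map_product_projection[of i I T]] by simp
    qed
    show "x = z" if x: "x \<in> topspace ?P" and z: "z \<in> topspace ?P"
      and eq: "\<And>E. E \<in> ?D \<Longrightarrow> x \<in> E \<longleftrightarrow> z \<in> E" for x z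
    proof (rule PiE_ext)
      show "x \<in> (\<Pi>\<^sub>E i\<in>I. topspace (T i))" "z \<in> (\<Pi>\<^sub>E i\<in>I. topspace (T i))" using x z by simp_all
      fix i assume i: "i \<in> I"
      have "(x i \<in> C) = (z i \<in> C)" if "C \<in> \<C> i" for C
      proof -
        have "?p i C \<in> ?D" using i that by blast
        from eq[OF this] show ?thesis using x z by simp
      qed
      moreover have "x i \<in> topspace (T i)" "z i \<in> topspace (T i)" using x z i by auto
      ultimately show "x i = z i" using clopen_codingD(4)[OF C[OF i]] by blast
    qed
    show "\<exists>F\<subseteq>?D. finite F \<and> (\<forall>z\<in>topspace ?P. (\<forall>E\<in>F. x \<in> E \<longleftrightarrow> z \<in> E) \<longrightarrow> z \<in> U)"
      if U: "openin ?P U" "x \<in> U" for U x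
    proof -
      have x: "x \<in> topspace ?P" using U openin_subset by blast
      obtain S where S: "finite {i \<in> I. S i \<noteq> topspace (T i)}"
        "\<forall>i\<in>I. openin (T i) (S i)" "x \<in> Pi\<^sub>E I S" "Pi\<^sub>E I S \<subseteq> U"
        using bspec[OF U(1)[unfolded openin_product_topology_alt] U(2)] by (elim exE conjE) (rule that)
      \<comment> \<open>Only the finitely many restricted coordinates contribute clopen sets to the
        required finite subfamily.\<close>
      let ?J = "{i \<in> I. S i \<noteq> topspace (T i)}"
      have "\<forall>i\<in>?J. \<exists>F. F \<subseteq> \<C> i \<and> finite F \<and>
        (\<forall>z\<in>topspace (T i). (\<forall>C\<in>F. x i \<in> C \<longleftrightarrow> z \<in> C) \<longrightarrow> z \<in> S i)"
      proof
        fix i assume "i \<in> ?J"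
        then have i: "i \<in> I" by simp
        show "\<exists>F\<subseteq>\<C> i. finite F \<and> (\<forall>z\<in>topspace (T i). (\<forall>C\<in>F. x i \<in> C \<longleftrightarrow> z \<in> C) \<longrightarrow> z \<in> S i)"
          by (rule clopen_codingD(5)[OF C[OF i] S(2)[THEN bspec, OF i] PiE_mem[OF S(3) i]])
      qed
      from bchoice[OF this] obtain F where F: "\<forall>i\<in>?J. F i \<subseteq> \<C> i \<and> finite (F i) \<and>
        (\<forall>z\<in>topspace (T i). (\<forall>C\<in>F i. x i \<in> C \<longleftrightarrow> z \<in> C) \<longrightarrow> z \<in> S i)"
        ..
      let ?F = "\<Union>i\<in>?J. ?p i ` F i"
      have "z \<in> U" if z: "z \<in> topspace ?P" "\<forall>E\<in>?F. x \<in> E \<longleftrightarrow> z \<in> E" for z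
      proof -
        have "z i \<in> S i" if i: "i \<in> I" for i
        proof (cases "S i = topspace (T i)")
          case True
          then show ?thesis using z(1) i by auto
        next
          case False
          then have iJ: "i \<in> ?J" using i by simp
          have "(x i \<in> C) = (z i \<in> C)" if "C \<in> F i" for C
          proof -
            have "?p i C \<in> ?F" using iJ that by blast
            from bspec[OF z(2) this] show ?thesis using x z(1) by simp
          qed
          moreover have "z i \<in> topspace (T i)" using z(1) i by auto
          ultimately show ?thesis using bspec[OF F iJ] by blast
        qed
        moreover have "z \<in> extensional I" using z(1) by (auto simp: PiE_iff)
        ultimately have "z \<in> Pi\<^sub>E I S" by (simp add: PiE_iff)
        then show ?thesis by (rule subsetD[OF S(4)])
      qed
      moreover have "finite ?F" using S(1) F by auto
      moreover have "?F \<subseteq> ?D" using F by blast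
      ultimately show ?thesis by (intro exI[of _ ?F]) simp
    qed
  qed
qed

section \<open>Zero-dimensionality of the factor \<open>Y\<close>\<close>

lemma set_of_reals_t1_space:
  assumes "set_of_reals Y"
  shows "t1_space Y"
proof -
  obtain A :: "real set" where "Y homeomorphic_space top_of_set A"
    using assms unfolding set_of_reals_def by blast
  then show ?thesis
    using homeomorphic_t1_space[of Y "top_of_set A"] t1_space_subtopology[OF t1_space_euclidean, of A]
    by blast
qed

lemma emeasure_lborel_UN_ball_le:
  fixes F :: "real set"
  assumes "finite F" "\<epsilon> > 0"
  shows "\<exists>\<delta>>0. emeasure lborel (\<Union>t\<in>F. ball t \<delta>) \<le> ennreal \<epsilon>"
proof -
  \<comment> \<open>The balls have total length at most \<open>card F\<close> times 2\<delta>; the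
    summand 1 avoids division by zero for empty \<open>F\<close>.\<close>
  define \<delta> where "\<delta> = \<epsilon> / (2 * (real (card F) + 1))"
  have pos: "\<delta> > 0" using assms(2) unfolding \<delta>_def by simp
  have "emeasure lborel (\<Union>t\<in>F. ball t \<delta>) \<le> (\<Sum>t\<in>F. emeasure lborel (ball t \<delta>))"
    using assms(1) by (intro emeasure_subadditive_finite) auto
  also have "\<dots> = (\<Sum>t\<in>F. ennreal (2 * \<delta>))"
    using pos by (intro sum.cong refl) (simp add: ball_eq_greaterThanLessThan)
  also have "\<dots> = ennreal (real (card F) * (2 * \<delta>))"
    using pos by (simp add: ennreal_mult ennreal_of_nat_eq_real_of_nat)
  also have "\<dots> \<le> ennreal \<epsilon>"
    using assms(2) unfolding \<delta>_def by (intro ennreal_leI) (simp add: field_simps)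
  finally show ?thesis using pos by blast
qed

text \<open>The members of the selected \<open>\<gamma>\<close>-sequence have measure tending to \<open>0\<close>, so their images
  cover only a null set.\<close>

lemma omega_gamma_image_no_interval:
  fixes A :: "real set"
  assumes Y: "omega_gamma Y" and f: "homeomorphic_map Y (top_of_set A) f" and "p < q"
  shows "\<not> {p<..<q} \<subseteq> A"
proof
  assume sub: "{p<..<q} \<subseteq> A"
  have fY: "f ` topspace Y = A" using homeomorphic_imp_surjective_map[OF f] by simp
  have cont: "continuous_map Y (top_of_set A) f" using f by (rule homeomorphic_imp_continuous_map)
  have "set_of_reals Y"
    unfolding set_of_reals_def using homeomorphic_map_imp_homeomorphic_space[OF f] by blast
  then have t1: "t1_space Y" by (rule set_of_reals_t1_space)
  \<comment> \<open>The measure is taken of an open superset \<open>G\<close>, since the image of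
    \<open>V\<close> is open only relative to \<open>A\<close> and may fail to be
    measurable.\<close>
  let ?V = "\<lambda>i::nat. {V. openin Y V \<and> (\<exists>G. open G \<and> f ` V \<subseteq> G \<and> emeasure lborel G \<le> ennreal ((1/2) ^ i))}"
  have ex: "\<exists>V\<in>?V i. F \<subseteq> V" if F: "finite F" "F \<subseteq> topspace Y" for i F
  proof -
    have "(1/2 :: real) ^ i > 0" by simp
    from emeasure_lborel_UN_ball_le[OF finite_imageI[OF F(1), of f] this]
    obtain \<delta> where \<delta>: "\<delta> > 0" "emeasure lborel (\<Union>t\<in>f ` F. ball t \<delta>) \<le> ennreal ((1/2) ^ i)"
      by blast
    define G where "G = (\<Union>t\<in>f ` F. ball t \<delta>)"
    have G: "open G" unfolding G_def by auto
    define V where "V = {y \<in> topspace Y. f y \<in> A \<inter> G}"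
    have "openin Y V"
      unfolding V_def using G by (intro openin_continuous_map_preimage[OF cont] openin_open_Int)
    moreover have "F \<subseteq> V"
    proof
      fix y assume y: "y \<in> F"
      then have "f y \<in> G" unfolding G_def using \<delta>(1) by (intro UN_I[of "f y"]) auto
      then show "y \<in> V" using y F(2) fY unfolding V_def by blast
    qed
    moreover have "f ` V \<subseteq> G" unfolding V_def by auto
    moreover have "emeasure lborel G \<le> ennreal ((1/2) ^ i)" unfolding G_def by (rule \<delta>(2))
    ultimately show ?thesis using G by (intro bexI[of _ V]) auto
  qed
  have "\<exists>(r :: nat \<Rightarrow> nat) V. strict_mono r \<and> (\<forall>n. V n \<in> ?V (r n)) \<and>
    (\<forall>y\<in>topspace Y. \<forall>\<^sub>F n in sequentially. y \<in> V n)"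
    by (rule omega_gamma_select[OF Y t1 ex]) simp_all
  then obtain r :: "nat \<Rightarrow> nat" and V where r: "strict_mono r" and V: "\<forall>n. V n \<in> ?V (r n)"
    and ev: "\<forall>y\<in>topspace Y. \<forall>\<^sub>F n in sequentially. y \<in> V n"
    by (elim exE conjE) (rule that)
  have "\<exists>G. open G \<and> f ` V n \<subseteq> G \<and> emeasure lborel G \<le> ennreal ((1/2) ^ r n)" for n
    using V[THEN spec, of n] by simp
  then obtain G where G: "\<And>n. open (G n)" "\<And>n. f ` V n \<subseteq> G n"
    "\<And>n. emeasure lborel (G n) \<le> ennreal ((1/2) ^ r n)" by metis
  have null: "(\<Inter>n\<in>{N..}. G n) \<in> null_sets lborel" for N
  proof -
    have meas: "(\<Inter>n\<in>{N..}. G n) \<in> sets borel"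
      using G(1) by (intro sets.countable_INT') auto
    have small: "emeasure lborel (\<Inter>n\<in>{N..}. G n) \<le> ennreal e" if e: "e > 0" for e
    proof -
      obtain k where k: "(1/2 :: real) ^ k < e" using real_arch_pow_inv[OF e, of "1/2"] by auto
      \<comment> \<open>This index lies in the range of the intersection, and
        \<open>k \<le> n \<le> r n\<close> makes \<open>G n\<close> small enough.\<close>
      define n where "n = max N k"
      have "emeasure lborel (\<Inter>n\<in>{N..}. G n) \<le> emeasure lborel (G n)"
        using G(1) by (intro emeasure_mono) (auto simp: n_def)
      also have "\<dots> \<le> ennreal ((1/2) ^ r n)" by (rule G(3))
      also have "\<dots> \<le> ennreal ((1/2) ^ k)"
        using strict_mono_imp_increasing[OF r, of n]
        by (intro ennreal_leI power_decreasing) (auto simp: n_def)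
      also have "\<dots> \<le> ennreal e" using k by (intro ennreal_leI) simp
      finally show ?thesis .
    qed
    have "emeasure lborel (\<Inter>n\<in>{N..}. G n) \<le> 0"
    proof (rule ennreal_le_epsilon)
      fix e :: real assume "0 < e"
      then show "emeasure lborel (\<Inter>n\<in>{N..}. G n) \<le> 0 + ennreal e" using small by simp
    qed
    then show ?thesis using meas by (simp add: null_sets_def)
  qed
  have "{p<..<q} \<subseteq> (\<Union>N. \<Inter>n\<in>{N..}. G n)"
  proof
    fix t assume "t \<in> {p<..<q}"
    then obtain y where y: "y \<in> topspace Y" "t = f y" using sub fY by (metis imageE subsetD)
    obtain N where "\<forall>n\<ge>N. y \<in> V n" using bspec[OF ev y(1)] unfolding eventually_sequentially by blast
    then have "t \<in> G n" if "n \<ge> N" for n using G(2)[of n] y(2) that by blast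
    then have "t \<in> (\<Inter>n\<in>{N..}. G n)" by simp
    then show "t \<in> (\<Union>N. \<Inter>n\<in>{N..}. G n)" by (rule UN_I[OF UNIV_I])
  qed
  moreover have "(\<Union>N. \<Inter>n\<in>{N..}. G n) \<in> null_sets lborel" using null by (intro null_sets_UN)
  ultimately have "{p<..<q} \<in> null_sets lborel" by (rule null_sets_subset[rotated 2]) simp
  then have "emeasure lborel {p<..<q} = 0" by (rule null_setsD1)
  then show False using \<open>p < q\<close> by (simp add: ennreal_eq_0_iff)
qed

text \<open>Since the image \<open>A\<close> contains no interval, its complement is dense in the
  line. For a cut point \<open>t\<close> outside \<open>A\<close>, the conditions
  \<open>f y < t\<close> and \<open>f y \<le> t\<close> coincide, so they define a clopen set;
  countably many dense cuts suffice.\<close>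

lemma clopen_coding_omega_gamma:
  assumes "set_of_reals Y" "omega_gamma Y"
  shows "\<exists>\<C>. clopen_coding Y \<C>"
proof -
  obtain A :: "real set" where "Y homeomorphic_space top_of_set A"
    using assms(1) unfolding set_of_reals_def by blast
  then obtain f where f: "homeomorphic_map Y (top_of_set A) f"
    unfolding homeomorphic_space by blast
  have fY: "f ` topspace Y = A" using homeomorphic_imp_surjective_map[OF f] by simp
  have inj: "inj_on f (topspace Y)" using homeomorphic_imp_injective_map[OF f] .
  have cont: "continuous_map Y euclideanreal f"
    using homeomorphic_imp_continuous_map[OF f] continuous_map_into_fulltopology by blast
  have "\<exists>d. p < d \<and> d < q \<and> d \<notin> A" if "p < q" for p q
    using omega_gamma_image_no_interval[OF assms(2) f that] by auto
  then obtain d where d: "\<And>p q. p < q \<Longrightarrow> p < d p q \<and> d p q < q \<and> d p q \<notin> A" by metis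
  \<comment> \<open>One missing point between each pair of rationals gives a countable set of cuts
    that is dense in the line.\<close>
  define D where "D = (\<lambda>(p, q). d p q) ` {(p, q) \<in> \<rat> \<times> \<rat>. p < q}"
  have D_between: "\<exists>t\<in>D. u < t \<and> t < v" if "u < v" for u v
  proof -
    obtain p where p: "p \<in> \<rat>" "u < p" "p < v" using Rats_dense_in_real[OF \<open>u < v\<close>] by blast
    obtain q where q: "q \<in> \<rat>" "p < q" "q < v" using Rats_dense_in_real[OF p(3)] by blast
    have "d p q \<in> D" unfolding D_def using p q by auto
    moreover have "u < d p q" "d p q < v" using d[OF q(2)] p q by auto
    ultimately show ?thesis by blast
  qed
  have D_A: "t \<notin> A" if "t \<in> D" for t using that d unfolding D_def by auto
  have "countable D"
  proof -
    have "countable (\<rat> \<times> \<rat> :: (real \<times> real) set)" by (intro countable_SIGMA countable_rat)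
    then show ?thesis
      unfolding D_def by (intro countable_image) (rule countable_subset[rotated], auto)
  qed
  let ?c = "\<lambda>t. {y \<in> topspace Y. f y < t}"
  have "clopen_coding Y (?c ` D)"
  proof (rule clopen_codingI)
    show "countable (?c ` D)" using \<open>countable D\<close> by simp
    fix C assume "C \<in> ?c ` D"
    then obtain t where t: "t \<in> D" "C = ?c t" by (elim imageE)
    have "C = {y \<in> topspace Y. f y \<in> {..<t}}" using t(2) by auto
    then show "openin Y C" using openin_continuous_map_preimage[OF cont, of "{..<t}"] by simp
    have "f y \<noteq> t" if "y \<in> topspace Y" for y using D_A[OF t(1)] fY that by blast
    then have "C = {y \<in> topspace Y. f y \<in> {..t}}" using t(2) by force
    then show "closedin Y C" using closedin_continuous_map_preimage[OF cont, of "{..t}"] by simp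
  next
    fix x z assume xz: "x \<in> topspace Y" "z \<in> topspace Y"
      and eq: "\<And>C. C \<in> ?c ` D \<Longrightarrow> x \<in> C \<longleftrightarrow> z \<in> C"
    have agree: "(f x < t) = (f z < t)" if "t \<in> D" for t
      using eq[of "?c t"] that xz by simp
    have "\<not> f x < f z"
    proof
      assume "f x < f z"
      then obtain t where "t \<in> D" "f x < t" "t < f z" using D_between by blast
      then show False using agree[of t] by simp
    qed
    moreover have "\<not> f z < f x"
    proof
      assume "f z < f x"
      then obtain t where "t \<in> D" "f z < t" "t < f x" using D_between by blast
      then show False using agree[of t] by simp
    qed
    ultimately have "f x = f z" by simp
    then show "x = z" using inj xz by (simp add: inj_on_eq_iff)
  next
    fix U x assume U: "openin Y U" "x \<in> U"
    then have sub: "U \<subseteq> topspace Y" by (simp add: openin_subset)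
    then have "openin (top_of_set A) (f ` U)" using homeomorphic_map_openness[OF f] U(1) by blast
    then obtain e where e: "e > 0" "\<And>t. \<lbrakk>t \<in> A; dist t (f x) < e\<rbrakk> \<Longrightarrow> t \<in> f ` U"
      using U(2) unfolding openin_euclidean_subtopology_iff by blast
    \<comment> \<open>Two cuts enclose \<open>f x\<close> within distance \<open>e\<close>; the
      answers to both confine \<open>f z\<close> to that neighbourhood.\<close>
    obtain s where s: "s \<in> D" "f x - e < s" "s < f x" using D_between[of "f x - e" "f x"] e(1) by auto
    obtain t where t: "t \<in> D" "f x < t" "t < f x + e" using D_between[of "f x" "f x + e"] e(1) by auto
    have "z \<in> U" if z: "z \<in> topspace Y" "\<forall>C\<in>{?c s, ?c t}. x \<in> C \<longleftrightarrow> z \<in> C" for z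
    proof -
      have "x \<in> topspace Y" using U(2) sub by blast
      then have "s \<le> f z" "f z < t" using z s t by auto
      then have "f x - e < f z" "f z < f x + e" using s(2) t(3) by linarith+
      then have "dist (f z) (f x) < e" by (simp add: dist_real_def abs_less_iff)
      moreover have "f z \<in> A" using fY z(1) by blast
      ultimately have "f z \<in> f ` U" using e(2) by blast
      then show ?thesis using inj sub z(1) by (simp add: inj_on_image_mem_iff)
    qed
    then show "\<exists>F\<subseteq>?c ` D. finite F \<and> (\<forall>z\<in>topspace Y. (\<forall>C\<in>F. x \<in> C \<longleftrightarrow> z \<in> C) \<longrightarrow> z \<in> U)"
      using s(1) t(1) by (intro exI[of _ "{?c s, ?c t}"]) simp
  qed
  then show ?thesis by blast
qed

section \<open>Products of towers\<close>

text \<open>A Galvin--Miller argument: near a finite subset of \<open>Y\<close> and the finite subsets of \<open>{1..i}\<close>,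
  membership in the covers is not affected by what the first coordinates do beyond a gap
  \<open>{Suc i..<e}\<close>.\<close>

lemma tower_space_gap_sequence:
  assumes U: "gamma_array (tower_space A I Y) U" and I: "finite I"
    and A: "\<And>i. i \<in> I \<Longrightarrow> fin_subsets \<subseteq> A i"
    and Y: "omega_gamma Y" "t1_space Y"
  shows "\<exists>a j V. strict_mono a \<and> (\<forall>n. 1 \<le> a n) \<and> (\<forall>n. n \<le> j n) \<and>
    (\<forall>y\<in>topspace Y. \<forall>\<^sub>F n in sequentially. y \<in> V n) \<and>
    (\<forall>n. \<forall>x\<in>(\<Pi>\<^sub>E i\<in>I. Pow {1..} \<inter> A i). \<forall>y\<in>V n.
       (\<forall>i\<in>I. x i \<inter> {a n..<a (Suc n)} = {}) \<longrightarrow> (\<forall>k\<le>n. (x, y) \<in> U k (j n)))"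
proof -
  let ?X = "\<Pi>\<^sub>E i\<in>I. Pow {1..} \<inter> A i"
  \<comment> \<open>At stage \<open>i\<close>, \<open>j\<close> is the column to be chosen and
    \<open>e\<close> the end of the gap that makes this choice safe.\<close>
  define good where "good i V j e \<longleftrightarrow> i \<le> j \<and> (\<forall>x\<in>?X. \<forall>y\<in>V.
    (\<forall>l\<in>I. x l \<inter> {Suc i..<e} = {}) \<longrightarrow> (\<forall>k\<le>i. (x, y) \<in> U k j))" for i j e :: nat and V
  let ?V = "\<lambda>i. {V. openin Y V \<and> (\<exists>j e. good i V j e)}"
  have op: "openin (tower_space A I Y) (U k j)" for k j using U unfolding gamma_array_def by blast
  have ex: "\<exists>V\<in>?V i. F \<subseteq> V" if F: "finite F" "F \<subseteq> topspace Y" for i F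
  proof -
    let ?B = "\<Pi>\<^sub>E l\<in>I. Pow {1..<Suc i}"
    have "finite (?B \<times> F)" using I F(1) by (intro finite_cartesian_product finite_PiE) auto
    have "p \<in> topspace (tower_space A I Y)" if p: "p \<in> ?B \<times> F" for p
    proof -
      have "fst p l \<in> Pow {1..} \<inter> A l" if l: "l \<in> I" for l
      proof -
        \<comment> \<open>Adding all finite sets to each factor makes the truncated tuples points of
          the space, so the array converges at them.\<close>
        have "fst p l \<subseteq> {1..<Suc i}" using p PiE_mem[of "fst p" I _ l] l by (force simp: mem_Times_iff)
        then have "fst p l \<in> fin_subsets"
          unfolding fin_subsets_def using finite_subset by fastforce
        then show ?thesis using A[OF l] unfolding fin_subsets_def by blast
      qed
      moreover have "fst p \<in> extensional I" using p by (auto simp: PiE_iff)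
      ultimately show ?thesis using p F(2) by (auto simp: topspace_tower_space mem_Times_iff PiE_iff)
    qed
    then have "\<forall>\<^sub>F j in sequentially. \<forall>k\<in>{..i}. p \<in> U k j" if "p \<in> ?B \<times> F" for p
      using U that unfolding gamma_array_def by (intro eventually_ball_finite) auto
    then have "\<forall>\<^sub>F j in sequentially. \<forall>p\<in>?B \<times> F. \<forall>k\<in>{..i}. p \<in> U k j"
      using \<open>finite (?B \<times> F)\<close> by (intro eventually_ball_finite) auto
    then obtain N where N: "\<forall>j\<ge>N. \<forall>p\<in>?B \<times> F. \<forall>k\<in>{..i}. p \<in> U k j"
      unfolding eventually_sequentially by blast
    define j where "j = max N i"
    define W where "W = (\<Inter>k\<in>{..i}. U k j)"
    have W: "openin (tower_space A I Y) W" unfolding W_def by (intro openin_INT2 op) auto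
    have "?B \<times> F \<subseteq> W"
    proof
      fix p assume p: "p \<in> ?B \<times> F"
      have "N \<le> j" by (simp add: j_def)
      from bspec[OF N[THEN spec, THEN mp, OF this] p] show "p \<in> W" unfolding W_def by simp
    qed
    from tower_space_common_gap[OF W I F this] obtain V e where V: "openin Y V" "F \<subseteq> V"
      "\<forall>x\<in>?X. \<forall>y\<in>V. (\<forall>l\<in>I. x l \<inter> {Suc i..<e} = {}) \<longrightarrow> (x, y) \<in> W"
      by (elim exE conjE) (rule that)
    have "good i V j e" unfolding good_def using V(3) unfolding W_def by (simp add: j_def)
    then show ?thesis using V(1,2) by (intro bexI[of _ V]) auto
  qed
  have "\<exists>(r :: nat \<Rightarrow> nat) V. strict_mono r \<and> (\<forall>n. V n \<in> ?V (r n)) \<and>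
    (\<forall>y\<in>topspace Y. \<forall>\<^sub>F n in sequentially. y \<in> V n)"
    by (rule omega_gamma_select[OF Y ex]) simp_all
  then obtain r :: "nat \<Rightarrow> nat" and V where r: "strict_mono r" and V: "\<forall>n. V n \<in> ?V (r n)"
    and ev: "\<forall>y\<in>topspace Y. \<forall>\<^sub>F n in sequentially. y \<in> V n"
    by (elim exE conjE) (rule that)
  have "\<exists>j e. good (r n) (V n) j e" for n using V[THEN spec, of n] by simp
  then obtain j e where je: "\<And>n. good (r n) (V n) (j n) (e n)" by metis
  \<comment> \<open>Passing to the stages \<sigma> puts the end of each gap no later than the start
    of the next one, so that \<open>{a n..<a (Suc n)}\<close> contains the gap required at stage
    \<open>n\<close>.\<close>
  define \<sigma> where "\<sigma> = rec_nat 0 (\<lambda>_ s. Suc (max s (e s)))"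
  have \<sigma>_Suc: "\<sigma> (Suc n) = Suc (max (\<sigma> n) (e (\<sigma> n)))" for n unfolding \<sigma>_def by simp
  have \<sigma>: "strict_mono \<sigma>" unfolding strict_mono_Suc_iff \<sigma>_Suc by (simp add: less_Suc_eq_le)
  have r_ge: "n \<le> r n" and \<sigma>_ge: "n \<le> \<sigma> n" for n
    using r \<sigma> by (simp_all add: strict_mono_imp_increasing)
  define a where "a n = Suc (r (\<sigma> n))" for n
  have "strict_mono a" using r \<sigma> unfolding a_def strict_mono_def by simp
  moreover have "n \<le> j (\<sigma> n)" for n
    using je[of "\<sigma> n"] r_ge[of "\<sigma> n"] \<sigma>_ge[of n] unfolding good_def by linarith
  moreover have "\<forall>\<^sub>F n in sequentially. y \<in> V (\<sigma> n)" if "y \<in> topspace Y" for y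
    using bspec[OF ev that] by (rule eventually_compose_filterlim[OF _ filterlim_ge_sequentially[OF \<sigma>_ge]])
  moreover have "(x, y) \<in> U k (j (\<sigma> n))"
    if x: "x \<in> ?X" and y: "y \<in> V (\<sigma> n)" and gap: "\<forall>i\<in>I. x i \<inter> {a n..<a (Suc n)} = {}" and k: "k \<le> n"
    for n x y k
  proof -
    have "e (\<sigma> n) \<le> a (Suc n)" using r_ge[of "\<sigma> (Suc n)"] unfolding a_def \<sigma>_Suc by linarith
    then have "\<forall>i\<in>I. x i \<inter> {Suc (r (\<sigma> n))..<e (\<sigma> n)} = {}" using gap unfolding a_def by fastforce
    moreover have "k \<le> r (\<sigma> n)" using k r_ge[of "\<sigma> n"] \<sigma>_ge[of n] by linarith
    ultimately show ?thesis using je[of "\<sigma> n"] x y unfolding good_def by blast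
  qed
  moreover have "1 \<le> a n" for n unfolding a_def by simp
  ultimately show ?thesis
    by (intro exI[of _ a] exI[of _ "\<lambda>n. j (\<sigma> n)"] exI[of _ "\<lambda>n. V (\<sigma> n)"]) simp
qed

section \<open>Slices and induction on the set of towers\<close>

lemma gamma_selective_mono: "\<lbrakk>gamma_selective T Q; P \<subseteq> Q\<rbrakk> \<Longrightarrow> gamma_selective T P"
  unfolding gamma_selective_def diagonal_def by (meson subsetD)

text \<open>Products of sets of reals need not embed in the line. Here every factor has a clopen
  coding, and codings of the factors combine to one of the product.\<close>

lemma set_of_reals_tower_space:
  assumes "countable I" "set_of_reals Y" "omega_gamma Y"
  shows "set_of_reals (tower_space A I Y)"
proof -
  have "\<exists>\<C>. \<forall>i. clopen_coding (subtopology cantor_pow (A i)) (\<C> i)"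
    by (rule choice) (rule allI, rule clopen_coding_cantor_pow)
  then obtain \<C> where C: "\<And>i. clopen_coding (subtopology cantor_pow (A i)) (\<C> i)" by blast
  obtain \<D> where D: "clopen_coding Y \<D>" using clopen_coding_omega_gamma[OF assms(2,3)] by blast
  show ?thesis
    unfolding tower_space_def
    by (rule clopen_coding_imp_set_of_reals clopen_coding_prod_topology clopen_coding_product_topology assms C D)+
qed

text \<open>The slice is a continuous image of \<open>R \<times> (tower_space A (I - {l}) Y)\<close>.\<close>

lemma gamma_selective_tower_space_slice:
  assumes prod: "\<And>T :: real topology. \<lbrakk>set_of_reals T; |topspace T| <o \<kappa>\<rbrakk> \<Longrightarrow> productively_S1_gamma_gamma T"
    and l: "l \<in> I" and R: "R \<subseteq> A l" "|R| <o \<kappa>"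
    and I: "countable I" and Y: "set_of_reals Y" "omega_gamma Y"
    and sel: "gamma_selective (tower_space A (I - {l}) Y) (topspace (tower_space A (I - {l}) Y))"
  shows "gamma_selective (tower_space A I Y) {p \<in> topspace (tower_space A I Y). fst p l \<in> R}"
proof -
  let ?Z = "tower_space A (I - {l}) Y" and ?R = "subtopology cantor_pow R"
  \<comment> \<open>Productivity is available for topologies on real numbers, so both factors are
    replaced by homeomorphic copies \<open>C\<close> and \<open>B\<close> in the line.\<close>
  have "set_of_reals ?Z" using I by (intro set_of_reals_tower_space Y) simp
  then obtain B :: "real set" where "?Z homeomorphic_space top_of_set B"
    unfolding set_of_reals_def by blast
  then obtain h h' where h: "homeomorphic_maps ?Z (top_of_set B) h h'"
    unfolding homeomorphic_space_def by blast
  obtain \<C> where "clopen_coding ?R \<C>" using clopen_coding_cantor_pow by blast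
  then have "set_of_reals ?R" by (rule clopen_coding_imp_set_of_reals)
  then obtain C :: "real set" where "?R homeomorphic_space top_of_set C"
    unfolding set_of_reals_def by blast
  then obtain g g' where g: "homeomorphic_maps ?R (top_of_set C) g g'"
    unfolding homeomorphic_space_def by blast
  have contg: "continuous_map (top_of_set C) ?R g'" and conth: "continuous_map (top_of_set B) ?Z h'"
    using g h unfolding homeomorphic_maps_def by blast+
  have "h ` topspace ?Z = topspace (top_of_set B)"
    using homeomorphic_imp_surjective_map homeomorphic_maps_map h by blast
  moreover have "continuous_map ?Z (top_of_set B) h" using h unfolding homeomorphic_maps_def by blast
  ultimately have "S1_gamma_gamma (top_of_set B)"
    using gamma_selective_image[OF sel] gamma_selective_imp_S1_gamma_gamma by metis
  moreover have "|topspace (top_of_set C)| <o \<kappa>"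
  proof -
    have "g ` topspace ?R = topspace (top_of_set C)"
      using homeomorphic_imp_surjective_map homeomorphic_maps_map g by blast
    then have "topspace (top_of_set C) \<subseteq> g ` R" by auto
    then have "|topspace (top_of_set C)| \<le>o |R|"
      using card_of_mono1 card_of_image ordLeq_transitive by blast
    then show ?thesis using R(2) by (rule ordLeq_ordLess_trans)
  qed
  moreover have "set_of_reals (top_of_set B')" for B' :: "real set"
    unfolding set_of_reals_def by blast
  ultimately have S1: "S1_gamma_gamma (prod_topology (top_of_set C) (top_of_set B))"
    using prod unfolding productively_S1_gamma_gamma_def by blast
  define P where "P = prod_topology (top_of_set C) (top_of_set B)"
  have topP: "topspace P = C \<times> B" unfolding P_def by simp
  have "continuous_map P (top_of_set C) fst" "continuous_map P (top_of_set B) snd"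
    unfolding P_def by (rule continuous_map_fst continuous_map_snd)+
  then have g'fst: "continuous_map P ?R (\<lambda>p. g' (fst p))" and h'snd: "continuous_map P ?Z (\<lambda>p. h' (snd p))"
    using continuous_map_compose[OF _ contg, unfolded comp_def]
      continuous_map_compose[OF _ conth, unfolded comp_def] by blast+
  \<comment> \<open>Undoes both homeomorphisms and inserts the element of \<open>R\<close> as the
    coordinate at \<open>l\<close>.\<close>
  define q where "q p = ((fst (h' (snd p)))(l := g' (fst p)), snd (h' (snd p)))" for p
  have fsth': "continuous_map P (product_topology (\<lambda>i. subtopology cantor_pow (A i)) (I - {l})) (\<lambda>p. fst (h' (snd p)))"
    and sndh': "continuous_map P Y (\<lambda>p. snd (h' (snd p)))"
    using continuous_map_compose[OF h'snd[unfolded tower_space_def] continuous_map_fst]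
      continuous_map_compose[OF h'snd[unfolded tower_space_def] continuous_map_snd]
    by (simp_all only: comp_def)
  have "continuous_map P (subtopology cantor_pow (A i)) (\<lambda>p. ((fst (h' (snd p)))(l := g' (fst p))) i)"
    if i: "i \<in> I" for i
  proof (cases "i = l")
    case True
    have "continuous_map P cantor_pow (\<lambda>p. g' (fst p))" "\<And>p. p \<in> topspace P \<Longrightarrow> g' (fst p) \<in> R"
      using g'fst by (auto simp: continuous_map_in_subtopology)
    then show ?thesis using True R(1) by (auto simp: continuous_map_in_subtopology)
  next
    case False
    then show ?thesis using fsth' i by (auto simp: continuous_map_componentwise)
  qed
  moreover have "(fst (h' (snd p)))(l := g' (fst p)) \<in> extensional I" if "p \<in> topspace P" for p
  proof -
    have "fst (h' (snd p)) \<in> extensional (I - {l})"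
      using fsth' that by (auto simp: continuous_map_componentwise)
    then show ?thesis using l by (auto simp: extensional_def)
  qed
  ultimately have "continuous_map P (product_topology (\<lambda>i. subtopology cantor_pow (A i)) I)
    (\<lambda>p. (fst (h' (snd p)))(l := g' (fst p)))"
    by (simp add: continuous_map_componentwise image_subset_iff)
  then have "continuous_map P (tower_space A I Y) q"
    using sndh' unfolding tower_space_def q_def by (simp add: continuous_map_pairwise comp_def)
  then have "gamma_selective (tower_space A I Y) (q ` topspace P)"
    by (rule gamma_selective_image[OF S1_gamma_gamma_imp_gamma_selective[OF S1[folded P_def]]])
  then show ?thesis
  proof (rule gamma_selective_mono)
    show "{p \<in> topspace (tower_space A I Y). fst p l \<in> R} \<subseteq> q ` topspace P"
    proof
      fix p assume p: "p \<in> {p \<in> topspace (tower_space A I Y). fst p l \<in> R}"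
      then have fst_p: "fst p \<in> (\<Pi>\<^sub>E i\<in>I. Pow {1..} \<inter> A i)"
        by (simp only: topspace_tower_space mem_Times_iff mem_Collect_eq)
      have pl: "fst p l \<in> topspace ?R" using PiE_mem[OF fst_p l] p by simp
      define z where "z = (restrict (fst p) (I - {l}), snd p)"
      have z: "z \<in> topspace ?Z"
        using fst_p p unfolding z_def topspace_tower_space by (simp add: PiE_iff mem_Times_iff)
      have "g (fst p l) \<in> topspace (top_of_set C)" "g' (g (fst p l)) = fst p l"
        using g pl unfolding homeomorphic_maps_def continuous_map_def by auto
      moreover have "h z \<in> topspace (top_of_set B)" "h' (h z) = z"
        using h z unfolding homeomorphic_maps_def continuous_map_def by auto
      moreover have "(restrict (fst p) (I - {l}))(l := fst p l) = fst p"
      proof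
        have "fst p \<in> extensional I" using fst_p by (simp add: PiE_iff)
        then show "((restrict (fst p) (I - {l}))(l := fst p l)) i = fst p i" for i
          by (auto simp: extensional_def)
      qed
      ultimately have "q (g (fst p l), h z) = p" "(g (fst p l), h z) \<in> topspace P"
        unfolding q_def topP by (simp_all add: z_def)
      then show "p \<in> q ` topspace P" by (metis imageI)
    qed
  qed
qed

text \<open>Induction over proper subsets of \<open>I\<close>, as slices at any \<open>l\<close>
  reduce to \<open>I - {l}\<close>. For empty \<open>I\<close> there are no slices, and the gap
  sequence alone settles the case.\<close>

lemma gamma_selective_tower_space:
  fixes Y :: "'y topology"
  assumes prod: "\<And>T :: real topology. \<lbrakk>set_of_reals T; |topspace T| <o \<kappa>\<rbrakk> \<Longrightarrow> productively_S1_gamma_gamma T"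
    and Y: "set_of_reals Y" "omega_gamma Y"
    and "finite I" "\<And>i. i \<in> I \<Longrightarrow> generalized_tower \<kappa> (X i)"
  shows "gamma_selective (tower_space (\<lambda>i. X i \<union> fin_subsets) I Y)
    (topspace (tower_space (\<lambda>i. X i \<union> fin_subsets) I Y))"
  using assms(4,5)
proof (induction I rule: finite_psubset_induct)
  case (psubset I)
  let ?A = "\<lambda>i. X i \<union> fin_subsets"
  let ?Z = "tower_space ?A I Y"
  show ?case
    unfolding gamma_selective_def
  proof (intro allI impI)
    fix U assume U: "gamma_array ?Z U"
    have "\<exists>a j V. strict_mono a \<and> (\<forall>n. 1 \<le> a n) \<and> (\<forall>n. n \<le> j n) \<and>
      (\<forall>y\<in>topspace Y. \<forall>\<^sub>F n in sequentially. y \<in> V n) \<and>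
      (\<forall>n. \<forall>x\<in>(\<Pi>\<^sub>E i\<in>I. Pow {1..} \<inter> ?A i). \<forall>y\<in>V n.
        (\<forall>i\<in>I. x i \<inter> {a n..<a (Suc n)} = {}) \<longrightarrow> (\<forall>k\<le>n. (x, y) \<in> U k (j n)))"
      by (rule tower_space_gap_sequence[OF U psubset.hyps(1) _ Y(2) set_of_reals_t1_space[OF Y(1)]]) auto
    then obtain a j V where a: "strict_mono a" "\<forall>n. 1 \<le> a n" and j: "\<forall>n. n \<le> j n"
      and V: "\<forall>y\<in>topspace Y. \<forall>\<^sub>F n in sequentially. y \<in> V n"
      and gap: "\<forall>n. \<forall>x\<in>(\<Pi>\<^sub>E i\<in>I. Pow {1..} \<inter> ?A i). \<forall>y\<in>V n.
        (\<forall>i\<in>I. x i \<inter> {a n..<a (Suc n)} = {}) \<longrightarrow> (\<forall>k\<le>n. (x, y) \<in> U k (j n))"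
      by (elim exE conjE) (rule that)
    have "\<exists>B S. infinite B \<and> (\<forall>l\<in>I. S l \<subseteq> X l \<and> |S l| <o \<kappa> \<and>
      (\<forall>x\<in>X l - S l. finite {n \<in> B. x \<inter> {a n..<a (Suc n)} \<noteq> {}}))"
      by (rule towers_intervals[OF psubset.hyps(1) psubset.prems a(1)]) (use a(2) in auto)
    then obtain B S where B: "infinite B" and S: "\<forall>l\<in>I. S l \<subseteq> X l \<and> |S l| <o \<kappa> \<and>
      (\<forall>x\<in>X l - S l. finite {n \<in> B. x \<inter> {a n..<a (Suc n)} \<noteq> {}})"
      by (elim exE conjE) (rule that)
    have ge: "n \<le> enumerate B n" and inB: "enumerate B n \<in> B" for n
      using B by (auto simp: le_enumerate enumerate_in_set)
    let ?P = "{p \<in> topspace ?Z. \<forall>i\<in>I. fst p i \<notin> S i}"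
    have "diagonal U (\<lambda>n. j (enumerate B n)) ?P"
      unfolding diagonal_def
    proof (intro conjI allI ballI)
      show "n \<le> j (enumerate B n)" for n using j ge order_trans by blast
      fix p assume p: "p \<in> ?P"
      have "\<forall>\<^sub>F n in sequentially. n \<in> B \<longrightarrow> fst p i \<inter> {a n..<a (Suc n)} = {}" if i: "i \<in> I" for i
      proof (cases "fst p i \<in> fin_subsets")
        \<comment> \<open>Since \<open>n \<le> a n\<close>, late gaps lie beyond a finite set; for a
          coordinate in the tower the choice of \<open>B\<close> gives the same conclusion along
          \<open>B\<close>.\<close>
        case True
        then obtain M where M: "\<forall>t\<in>fst p i. t < M"
          unfolding fin_subsets_def by (auto simp: finite_nat_set_iff_bounded)
        have "fst p i \<inter> {a n..<a (Suc n)} = {}" if "n \<ge> M" for n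
          using M strict_mono_imp_increasing[OF a(1), of n] that by fastforce
        then show ?thesis unfolding eventually_sequentially by blast
      next
        case False
        moreover have "fst p i \<in> X i \<union> fin_subsets"
          using p i by (auto simp: topspace_tower_space mem_Times_iff dest: PiE_mem)
        ultimately have "fst p i \<in> X i - S i" using p i by blast
        then have "finite {n \<in> B. fst p i \<inter> {a n..<a (Suc n)} \<noteq> {}}" using S i by blast
        then show ?thesis by (simp flip: cofinite_eq_sequentially add: eventually_cofinite)
      qed
      then have "\<forall>\<^sub>F n in sequentially. \<forall>i\<in>I. n \<in> B \<longrightarrow> fst p i \<inter> {a n..<a (Suc n)} = {}"
        by (intro eventually_ball_finite psubset.hyps(1)) blast
      moreover have "\<forall>\<^sub>F n in sequentially. snd p \<in> V n"
        using V p by (auto simp: topspace_tower_space)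
      ultimately have "\<forall>\<^sub>F n in sequentially. n \<in> B \<longrightarrow> (\<forall>k\<le>n. p \<in> U k (j n))"
      proof (rule eventually_elim2, intro impI)
        fix n assume n: "\<forall>i\<in>I. n \<in> B \<longrightarrow> fst p i \<inter> {a n..<a (Suc n)} = {}" "snd p \<in> V n" "n \<in> B"
        have "fst p \<in> (\<Pi>\<^sub>E i\<in>I. Pow {1..} \<inter> ?A i)"
          using p by (simp only: topspace_tower_space mem_Times_iff mem_Collect_eq)
        from gap[THEN spec, THEN bspec, THEN bspec, THEN mp, OF this n(2)] n(1,3)
        show "\<forall>k\<le>n. p \<in> U k (j n)" by simp
      qed
      \<comment> \<open>Moving along the enumeration of \<open>B\<close> loses no row, because
        \<open>n \<le> enumerate B n\<close>.\<close>
      then have "\<forall>\<^sub>F n in sequentially. enumerate B n \<in> B \<longrightarrow>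
          (\<forall>k\<le>enumerate B n. p \<in> U k (j (enumerate B n)))"
        by (rule eventually_compose_filterlim[OF _ filterlim_ge_sequentially[OF ge]])
      then show "\<forall>\<^sub>F n in sequentially. \<forall>k\<le>n. p \<in> U k (j (enumerate B n))"
        by (rule eventually_mono) (use ge inB order_trans in blast)
    qed
    moreover have "gamma_selective ?Z {p \<in> topspace ?Z. fst p l \<in> S l}" if l: "l \<in> I" for l
    proof (rule gamma_selective_tower_space_slice[OF prod l _ _ _ Y])
      show "S l \<subseteq> ?A l" "|S l| <o \<kappa>" using S l by auto
      show "countable I" using psubset.hyps(1) by (rule countable_finite)
      show "gamma_selective (tower_space ?A (I - {l}) Y) (topspace (tower_space ?A (I - {l}) Y))"
        using l psubset.prems by (intro psubset.IH) auto
    qed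
    ultimately have "\<exists>j'. diagonal U j' (?P \<union> (\<Union>l\<in>I. {p \<in> topspace ?Z. fst p l \<in> S l}))"
      by (intro diagonal_extend_finite[OF U _ psubset.hyps(1)])
    moreover have "?P \<union> (\<Union>l\<in>I. {p \<in> topspace ?Z. fst p l \<in> S l}) = topspace ?Z" by blast
    ultimately show "\<exists>j'. diagonal U j' (topspace ?Z)" by simp
  qed
qed

theorem theorem5p1:
  fixes \<kappa> :: "'k rel" and m :: nat and X :: "nat \<Rightarrow> nat set set" and Y :: "'y topology"
  assumes "Well_order \<kappa>" and "uncountable (Field \<kappa>)"
    and "\<And>T :: real topology. \<lbrakk>set_of_reals T; |topspace T| <o \<kappa>\<rbrakk> \<Longrightarrow> productively_S1_gamma_gamma T"
    and "m \<ge> 1"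
    and "\<And>i. i \<in> {1..m} \<Longrightarrow> generalized_tower \<kappa> (X i)"
    and "set_of_reals Y" and "omega_gamma Y"
  shows "S1_gamma_gamma
    (prod_topology
      (product_topology (\<lambda>i. subtopology cantor_pow (X i \<union> fin_subsets)) {1..m}) Y)"
  using gamma_selective_imp_S1_gamma_gamma[OF gamma_selective_tower_space[OF assms(3,6,7) finite_atLeastAtMost assms(5)]]
  unfolding tower_space_def .

end
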